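(* Let $Y$ be a quasiconformal Jordan domain and let $\phi \colon \mathbb{D} \rightarrow Y$ be a quasiconformal homeomorphism. Then there exists an extension $\Phi \colon \overline{\mathbb{D}} \rightarrow \overline{Y}$ of $\phi$ that is surjective, monotone, and satisfies $\Phi(\mathbb{S}^{1}) = \partial Y$.
   Context: $\mathbb{D}$ is the open unit disk in $\mathbb{R}^{2}$, $\overline{\mathbb{D}}$ its closure, $\mathbb{S}^{1}$ its boundary circle. $\mathcal{H}^{2}_{Z}$ denotes the Hausdorff $2$-measure of a metric space $Z$, normalized so that $\mathcal{H}^2_{\mathbb{R}^2}$ is Lebesgue measure. Modulus: let $Z$ be a metric space with locally finite $\mathcal{H}^2_Z$ and $\Gamma$ a family of paths in $Z$. A Borel function $\rho \colon Z \to [0,\infty]$ is admissible for $\Gamma$ if $\int_{\gamma} \rho\, ds \geq 1$ for every rectifiable $\gamma \in \Gamma$. The modulus is $\operatorname{Mod}\Gamma = \inf \int_Z \rho^2 \, d\mathcal{H}^2_Z$, the infimum over all admissible $\rho$. A homeomorphism $\psi \colon Z \to W$ between metric spaces with locally finite Hausdorff $2$-measure is $K$-quasiconformal ($K \geq 1$) if $K^{-1}\operatorname{Mod}\Gamma \leq \operatorname{Mod}\psi\Gamma \leq K \operatorname{Mod}\Gamma$ for all path families $\Gamma$ in $Z$, where $\psi\Gamma = \{\psi\circ\gamma : \gamma\in\Gamma\}$; it is quasiconformal if it is $K$-quasiconformal for some $K$. A metric surface is a metric space homeomorphic to a $2$-manifold and with locally finite Hausdorff $2$-measure. A metric surface $(Y,d_Y)$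 is a metric Jordan domain if its metric completion $\overline{Y}$ is homeomorphic to $\overline{\mathbb{D}}$, the boundary $\partial Y = \overline{Y}\setminus Y$ is homeomorphic to $\mathbb{S}^1$, and $\mathcal{H}^2_{\overline{Y}}(\overline{Y}) < \infty$. It is a quasiconformal Jordan domain if in addition there exists a quasiconformal homeomorphism $\mathbb{D}\to Y$. A map is monotone if it is continuous and the preimage of every point is a continuum, i.e. compact and connected. *)

theory Defs
  imports "HOL-Analysis.Analysis"
begin

text \<open>
  A metric space is a set in a type of class \<^class>\<open>metric_space\<close>, with the induced distance and the
  relative topology; the plane is \<^typ>\<open>complex\<close>.
\<close>

section \<open>Hausdorff 2-measure\<close>

text \<open>The library's \<^const>\<open>diameter\<close> is real-valued, hence meaningless for unbounded sets.\<close>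

definition ediameter :: "'a::metric_space set \<Rightarrow> ennreal" where
  "ediameter U = (SUP x\<in>U. SUP y\<in>U. ennreal (dist x y))"

text \<open>
  The factor \<open>pi / 4\<close> is the area of a disk of unit diameter; with it, the Hausdorff 2-measure
  of the plane is Lebesgue measure. Covering by subsets of the ambient type or of a
  subspace containing \<open>A\<close> gives the same value, so this is also \<open>H\<^sup>2\<close> of every such subspace.
\<close>

definition hausdorff2 :: "'a::metric_space set \<Rightarrow> ennreal" where
  "hausdorff2 A =
     (SUP \<delta>\<in>{0::real<..}.
        INF U\<in>{U :: nat \<Rightarrow> 'a set. A \<subseteq> (\<Union>i. U i) \<and> (\<forall>i. ediameter (U i) \<le> ennreal \<delta>)}.
          (\<Sum>i. ennreal (pi / 4) * ediameter (U i) ^ 2))"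

text \<open>
  \<^const>\<open>hausdorff2\<close> is a metric outer measure, hence countably additive on the relative Borel
  sets of \<open>Z\<close> (Caratheodory); so \<^const>\<open>measure_of\<close> does not fall back to the zero measure here.
\<close>

definition hausdorff2_measure :: "'a::metric_space set \<Rightarrow> 'a measure" where
  "hausdorff2_measure Z = measure_of Z (sets (restrict_space borel Z)) hausdorff2"

definition locally_finite_hausdorff2 :: "'a::metric_space set \<Rightarrow> bool" where
  "locally_finite_hausdorff2 Z \<longleftrightarrow> (\<forall>z\<in>Z. \<exists>r>0. hausdorff2 (Z \<inter> ball z r) < \<infinity>)"

section \<open>Length and path integrals\<close>

definition curve_length :: "(real \<Rightarrow> 'a::metric_space) \<Rightarrow> real \<Rightarrow> real \<Rightarrow> ennreal" where
  "curve_length \<gamma> a b =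
     Sup {(\<Sum>i<n. ennreal (dist (\<gamma> (t i)) (\<gamma> (t (Suc i))))) | (n::nat) (t :: nat \<Rightarrow> real).
            (\<forall>i\<le>n. t i \<in> {a..b}) \<and> (\<forall>i<n. t i \<le> t (Suc i))}"

definition path_length :: "(real \<Rightarrow> 'a::metric_space) \<Rightarrow> ennreal" where
  "path_length \<gamma> = curve_length \<gamma> 0 1"

definition rectifiable :: "(real \<Rightarrow> 'a::metric_space) \<Rightarrow> bool" where
  "rectifiable \<gamma> \<longleftrightarrow> path_length \<gamma> < \<infinity>"

text \<open>
  The arc length parametrization of a rectifiable path, on \<open>[0, length]\<close>. All parameters \<open>u\<close> with
  the same initial length have the same \<open>\<gamma> u\<close>, so the choice is immaterial.
\<close>

definition arclength_param :: "(real \<Rightarrow> 'a::metric_space) \<Rightarrow> real \<Rightarrow> 'a" where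
  "arclength_param \<gamma> s = \<gamma> (SOME u. u \<in> {0..1} \<and> curve_length \<gamma> 0 u = ennreal s)"

definition path_integral :: "('a::metric_space \<Rightarrow> ennreal) \<Rightarrow> (real \<Rightarrow> 'a) \<Rightarrow> ennreal" where
  "path_integral \<rho> \<gamma> =
     (\<integral>\<^sup>+ s \<in> {0..enn2real (path_length \<gamma>)}. \<rho> (arclength_param \<gamma> s) \<partial>lborel)"

section \<open>Modulus and quasiconformal homeomorphisms\<close>

text \<open>
  Paths are parametrized by \<open>[0,1]\<close> as in the library; length, path integral and hence modulus do
  not depend on the parametrization.
\<close>

definition paths_in :: "'a::metric_space set \<Rightarrow> (real \<Rightarrow> 'a) set" where
  "paths_in Z = {\<gamma>. path \<gamma> \<and> path_image \<gamma> \<subseteq> Z}"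

definition admissible ::
    "'a::metric_space set \<Rightarrow> (real \<Rightarrow> 'a) set \<Rightarrow> ('a \<Rightarrow> ennreal) \<Rightarrow> bool" where
  "admissible Z \<Gamma> \<rho> \<longleftrightarrow>
     \<rho> \<in> borel_measurable (restrict_space borel Z) \<and>
     (\<forall>\<gamma>\<in>\<Gamma>. rectifiable \<gamma> \<longrightarrow> 1 \<le> path_integral \<rho> \<gamma>)"

definition Modulus :: "'a::metric_space set \<Rightarrow> (real \<Rightarrow> 'a) set \<Rightarrow> ennreal" where
  "Modulus Z \<Gamma> = (INF \<rho>\<in>{\<rho>. admissible Z \<Gamma> \<rho>}. \<integral>\<^sup>+ z. \<rho> z ^ 2 \<partial>hausdorff2_measure Z)"

definition K_quasiconformal ::
    "real \<Rightarrow> 'a::metric_space set \<Rightarrow> 'b::metric_space set \<Rightarrow> ('a \<Rightarrow> 'b) \<Rightarrow> bool" where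
  "K_quasiconformal K Z W \<psi> \<longleftrightarrow>
     locally_finite_hausdorff2 Z \<and> locally_finite_hausdorff2 W \<and>
     (\<exists>\<psi>'. homeomorphism Z W \<psi> \<psi>') \<and>
     (\<forall>\<Gamma> \<subseteq> paths_in Z.
        ennreal (1 / K) * Modulus Z \<Gamma> \<le> Modulus W ((\<lambda>\<gamma>. \<psi> \<circ> \<gamma>) ` \<Gamma>) \<and>
        Modulus W ((\<lambda>\<gamma>. \<psi> \<circ> \<gamma>) ` \<Gamma>) \<le> ennreal K * Modulus Z \<Gamma>)"

definition quasiconformal ::
    "'a::metric_space set \<Rightarrow> 'b::metric_space set \<Rightarrow> ('a \<Rightarrow> 'b) \<Rightarrow> bool" where
  "quasiconformal Z W \<psi> \<longleftrightarrow> (\<exists>K\<ge>1. K_quasiconformal K Z W \<psi>)"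

section \<open>Metric surfaces and Jordan domains\<close>

text \<open>Topological 2-manifolds without boundary; the Hausdorff property is automatic.\<close>

definition two_manifold :: "'a::metric_space set \<Rightarrow> bool" where
  "two_manifold Y \<longleftrightarrow>
     second_countable (top_of_set Y) \<and>
     (\<forall>y\<in>Y. \<exists>U (V :: complex set).
          openin (top_of_set Y) U \<and> y \<in> U \<and> open V \<and> U homeomorphic V)"

definition metric_surface :: "'a::metric_space set \<Rightarrow> bool" where
  "metric_surface Y \<longleftrightarrow> two_manifold Y \<and> locally_finite_hausdorff2 Y"

text \<open>
  \<open>Y\<close> is identified with its isometric image in the completion, as is implicit in \<open>\<partial>Y = Yc - Y\<close>.
  This loses no generality: \<open>x \<mapsto> (\<lambda>y. dist x y - dist a y)\<close> embeds any metric space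
  isometrically into a type of bounded continuous functions, which is complete.
\<close>

definition metric_completion :: "'a::metric_space set \<Rightarrow> 'a set \<Rightarrow> bool" where
  "metric_completion Y Yc \<longleftrightarrow> complete Yc \<and> Y \<subseteq> Yc \<and> Yc \<subseteq> closure Y"

definition metric_Jordan_domain :: "'a::metric_space set \<Rightarrow> 'a set \<Rightarrow> bool" where
  "metric_Jordan_domain Y Yc \<longleftrightarrow>
     metric_surface Y \<and> metric_completion Y Yc \<and>
     Yc homeomorphic (cball 0 1 :: complex set) \<and>
     (Yc - Y) homeomorphic (sphere 0 1 :: complex set) \<and>
     hausdorff2 Yc < \<infinity>"

definition quasiconformal_Jordan_domain :: "'a::metric_space set \<Rightarrow> 'a set \<Rightarrow> bool" where
  "quasiconformal_Jordan_domain Y Yc \<longleftrightarrow>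
     metric_Jordan_domain Y Yc \<and> (\<exists>\<psi>. quasiconformal (ball 0 1 :: complex set) Y \<psi>)"

section \<open>Monotone maps\<close>

text \<open>The library's \<^const>\<open>monotone_map\<close> demands neither continuity nor compact fibres.\<close>

definition continuum_monotone_map ::
    "'a::topological_space set \<Rightarrow> 'b::topological_space set \<Rightarrow> ('a \<Rightarrow> 'b) \<Rightarrow> bool" where
  "continuum_monotone_map S T f \<longleftrightarrow>
     continuous_on S f \<and> f ` S \<subseteq> T \<and>
     (\<forall>y\<in>T. compact {x\<in>S. f x = y} \<and> connected {x\<in>S. f x = y})"

end

theory Submission
  imports Defs
begin

text \<open>
  Since the closure \<open>Yc\<close> is homeomorphic to the closed disk by some \<open>h\<close>, and \<open>h\<close> maps the boundary of \<open>Y\<close>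
  onto the unit circle (\<open>Jordan_domain_interior\<close>), extending \<open>\<phi>\<close> amounts to extending the homeomorphism
  \<open>h \<circ> \<phi>\<close> of the open unit disk onto itself. As \<open>h\<close> is uniformly continuous on the compact set \<open>Yc\<close>,
  sets of small diameter in \<open>Y\<close> have small images in the disk.

  The analytic input is the length-area principle. Near a boundary point \<open>z\<close> the disk is swept out by
  crosscuts around \<open>z\<close>, one for each small height \<open>r\<close>, of length comparable to \<open>r\<close>. A path family that contains
  a piece of every one of them has infinite modulus, because the integral of \<open>1 / r\<close> diverges at zero
  (\<open>Modulus_corner_segments_infinite\<close>). Their images in \<open>Y\<close> cannot all have diameter bounded below, for
  then the finite area of \<open>Y\<close> would make the modulus of the image family finite
  (\<open>Modulus_le_if_endpoints_apart\<close>). So arbitrarily close to \<open>z\<close> there are crosscuts with arbitrarily short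
  images (\<open>quasiconformal_short_crosscut\<close>). For the lower bound on the modulus, Hausdorff measure on the
  disk has to be compared with Lebesgue measure, which presupposes that it is a measure on the Borel
  sets in the first place (\<open>measure_space_hausdorff2_borel\<close>, \<open>nn_integral_le_hausdorff2_measure\<close>).

  The rest is topology of the disk. A crosscut with short image close to the circle cuts off a region
  with small image (\<open>small_oscillation_near_boundary\<close>), because the radii of the image disk cannot enter
  that region without meeting the crosscut. Hence the oscillation tends to zero at each boundary point,
  the map is uniformly continuous, and it extends to the closed disk. The extension is monotone because
  the preimages of the convex sets \<open>ball 0 1 \<inter> ball y e\<close> are connected, and the fibre over \<open>y\<close> is the
  intersection of their closures (\<open>closure_extension_monotone\<close>).
\<close>

section \<open>Hausdorff measure is a measure on Borel sets\<close>

definition hausdorff_content :: "real \<Rightarrow> 'a::metric_space set \<Rightarrow> ennreal" where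
  "hausdorff_content \<delta> A =
     (INF U\<in>{U :: nat \<Rightarrow> 'a set. A \<subseteq> (\<Union>i. U i) \<and> (\<forall>i. ediameter (U i) \<le> ennreal \<delta>)}.
        (\<Sum>i. ennreal (pi / 4) * ediameter (U i) ^ 2))"

lemma hausdorff2_eq_SUP_content: "hausdorff2 A = (SUP \<delta>\<in>{0<..}. hausdorff_content \<delta> A)"
  by (simp add: hausdorff2_def hausdorff_content_def)

lemma hausdorff_content_le_hausdorff2: "0 < \<delta> \<Longrightarrow> hausdorff_content \<delta> A \<le> hausdorff2 A"
  unfolding hausdorff2_eq_SUP_content by (rule SUP_upper) simp

lemma hausdorff_content_le:
  assumes "A \<subseteq> (\<Union>i. U i)" "\<And>i. ediameter (U i) \<le> ennreal \<delta>"
  shows "hausdorff_content \<delta> A \<le> (\<Sum>i. ennreal (pi / 4) * ediameter (U i) ^ 2)"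
  unfolding hausdorff_content_def using assms by (intro INF_lower) auto

lemma hausdorff_content_antimono:
  assumes "\<delta> \<le> \<delta>'"
  shows "hausdorff_content \<delta>' A \<le> hausdorff_content \<delta> A"
  unfolding hausdorff_content_def
  using assms by (intro INF_superset_mono) (auto intro: order_trans ennreal_leI)

lemma hausdorff_content_mono:
  assumes "A \<subseteq> B"
  shows "hausdorff_content \<delta> A \<le> hausdorff_content \<delta> B"
  unfolding hausdorff_content_def using assms by (intro INF_superset_mono) auto

lemma hausdorff2_mono: "A \<subseteq> B \<Longrightarrow> hausdorff2 A \<le> hausdorff2 B"
  unfolding hausdorff2_eq_SUP_content by (intro SUP_mono) (auto intro: hausdorff_content_mono)

lemma ediameter_empty [simp]: "ediameter {} = 0"
  by (simp add: ediameter_def bot_ennreal)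

lemma dist_le_ediameter: "x \<in> U \<Longrightarrow> y \<in> U \<Longrightarrow> ennreal (dist x y) \<le> ediameter U"
  unfolding ediameter_def by (rule SUP_upper2[of x], assumption, rule SUP_upper2[of y]) auto

lemma hausdorff2_empty [simp]: "hausdorff2 {} = 0"
proof -
  have "hausdorff_content \<delta> ({} :: 'a set) \<le> (\<Sum>i. ennreal (pi / 4) * ediameter ({} :: 'a set) ^ 2)" for \<delta>
    by (rule hausdorff_content_le) auto
  then show ?thesis
    by (simp add: hausdorff2_eq_SUP_content)
qed

lemma ennreal_le_suminf: "f m \<le> (\<Sum>i. f i)" for f :: "nat \<Rightarrow> ennreal"
  using sum_le_suminf[of f "{m}"] by simp

lemma hausdorff_content_countable_subadditive:
  "hausdorff_content \<delta> (\<Union>m. A m) \<le> (\<Sum>m. hausdorff_content \<delta> (A m))"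
proof (rule ennreal_le_epsilon)
  fix e :: real assume e: "0 < e"
  assume fin: "(\<Sum>m. hausdorff_content \<delta> (A m)) < top"
  have fin': "hausdorff_content \<delta> (A m) < top" for m
    using order_le_less_trans[OF ennreal_le_suminf fin] .
  have "\<exists>U. A m \<subseteq> (\<Union>i. U i) \<and> (\<forall>i. ediameter (U i) \<le> ennreal \<delta>) \<and>
          (\<Sum>i. ennreal (pi / 4) * ediameter (U i) ^ 2) \<le> hausdorff_content \<delta> (A m) + ennreal (e * (1 / 2) ^ Suc m)" for m
  proof -
    have "hausdorff_content \<delta> (A m) < hausdorff_content \<delta> (A m) + ennreal (e * (1 / 2) ^ Suc m)"
      using fin'[of m] e by (cases "hausdorff_content \<delta> (A m)") (auto simp: ennreal_plus[symmetric] ennreal_less_iff simp del: ennreal_plus)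
    then obtain U where "A m \<subseteq> (\<Union>i. U i)" "\<forall>i. ediameter (U i) \<le> ennreal \<delta>"
      "(\<Sum>i. ennreal (pi / 4) * ediameter (U i) ^ 2) < hausdorff_content \<delta> (A m) + ennreal (e * (1 / 2) ^ Suc m)"
      unfolding hausdorff_content_def[of \<delta> "A m"] INF_less_iff by blast
    then show ?thesis by (blast intro: less_imp_le)
  qed
  then obtain U where U: "\<And>m. A m \<subseteq> (\<Union>i. U m i)" "\<And>m i. ediameter (U m i) \<le> ennreal \<delta>"
    "\<And>m. (\<Sum>i. ennreal (pi / 4) * ediameter (U m i) ^ 2) \<le> hausdorff_content \<delta> (A m) + ennreal (e * (1 / 2) ^ Suc m)"
    by metis
  define V where "V k = (case prod_decode k of (m, i) \<Rightarrow> U m i)" for k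
  have "(\<Union>m. A m) \<subseteq> (\<Union>k. V k)"
  proof
    fix x assume "x \<in> (\<Union>m. A m)"
    then obtain m i where "x \<in> U m i" using U(1) by blast
    then have "x \<in> V (prod_encode (m, i))" by (simp add: V_def)
    then show "x \<in> (\<Union>k. V k)" by blast
  qed
  then have "hausdorff_content \<delta> (\<Union>m. A m) \<le> (\<Sum>k. ennreal (pi / 4) * ediameter (V k) ^ 2)"
    by (rule hausdorff_content_le) (auto simp: V_def U(2) split: prod.split)
  also have "\<dots> = (\<Sum>k. (\<lambda>(m, i). ennreal (pi / 4) * ediameter (U m i) ^ 2) (prod_decode k))"
    by (simp add: V_def split_beta)
  also have "\<dots> = (\<Sum>m. \<Sum>i. ennreal (pi / 4) * ediameter (U m i) ^ 2)"
    by (rule suminf_ennreal_2dimen) simp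
  also have "\<dots> \<le> (\<Sum>m. hausdorff_content \<delta> (A m) + ennreal (e * (1 / 2) ^ Suc m))"
    by (intro suminf_le U(3)) auto
  also have "\<dots> = (\<Sum>m. hausdorff_content \<delta> (A m)) + (\<Sum>m. ennreal (e * (1 / 2) ^ Suc m))"
    by (rule suminf_add[symmetric]) auto
  also have "(\<Sum>m. ennreal (e * (1 / 2) ^ Suc m)) = ennreal e"
  proof (rule suminf_ennreal_eq)
    show "(\<lambda>m. e * (1 / 2) ^ Suc m) sums e"
      using sums_mult[OF power_half_series, of e] by simp
  qed (use e in auto)
  finally show "hausdorff_content \<delta> (\<Union>m. A m) \<le> (\<Sum>m. hausdorff_content \<delta> (A m)) + ennreal e" .
qed

lemma hausdorff2_countable_subadditive: "hausdorff2 (\<Union>m. A m) \<le> (\<Sum>m. hausdorff2 (A m))"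
  unfolding hausdorff2_eq_SUP_content[of "\<Union>m. A m"]
proof (rule SUP_least)
  fix \<delta> :: real assume "\<delta> \<in> {0<..}"
  then have "(\<Sum>m. hausdorff_content \<delta> (A m)) \<le> (\<Sum>m. hausdorff2 (A m))"
    by (intro suminf_le hausdorff_content_le_hausdorff2) auto
  then show "hausdorff_content \<delta> (\<Union>m. A m) \<le> (\<Sum>m. hausdorff2 (A m))"
    using hausdorff_content_countable_subadditive order_trans by blast
qed

lemma hausdorff2_Un_le: "hausdorff2 (A \<union> B) \<le> hausdorff2 A + hausdorff2 B"
proof -
  have "hausdorff2 (A \<union> B) = hausdorff2 (\<Union>m. binaryset A B m)"
    by (simp add: UN_binaryset_eq)
  also have "\<dots> \<le> (\<Sum>m. hausdorff2 (binaryset A B m))"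
    by (rule hausdorff2_countable_subadditive)
  also have "\<dots> = hausdorff2 A + hausdorff2 B"
    by (rule suminf_binaryset_eq) simp
  finally show ?thesis .
qed

text \<open>
  A set of diameter less than \<open>d\<close> cannot meet both \<open>A\<close> and \<open>B\<close>, so a cover of \<open>A \<union> B\<close> by such
  sets splits into a cover of \<open>A\<close> and a cover of \<open>B\<close>.
\<close>

lemma hausdorff_content_separated:
  assumes "0 < \<delta>" "\<delta> < d" and sep: "\<And>x y. x \<in> A \<Longrightarrow> y \<in> B \<Longrightarrow> d \<le> dist x y"
  shows "hausdorff_content \<delta> A + hausdorff_content \<delta> B \<le> hausdorff_content \<delta> (A \<union> B)"
  unfolding hausdorff_content_def[of \<delta> "A \<union> B"]
proof (rule INF_greatest)
  fix U :: "nat \<Rightarrow> 'a set"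
  assume "U \<in> {U. A \<union> B \<subseteq> (\<Union>i. U i) \<and> (\<forall>i. ediameter (U i) \<le> ennreal \<delta>)}"
  then have U: "A \<union> B \<subseteq> (\<Union>i. U i)" "\<And>i. ediameter (U i) \<le> ennreal \<delta>" by auto
  define V where "V C i = (if U i \<inter> C = {} then {} else U i)" for C i
  have V: "hausdorff_content \<delta> C \<le> (\<Sum>i. ennreal (pi / 4) * ediameter (V C i) ^ 2)" if "C \<subseteq> A \<union> B" for C
  proof (rule hausdorff_content_le)
    show "C \<subseteq> (\<Union>i. V C i)"
    proof
      fix x assume "x \<in> C"
      then have "x \<in> A \<union> B" using that by blast
      then have "x \<in> (\<Union>i. U i)" using U(1) by (rule subsetD[rotated])
      then obtain i where "x \<in> U i" by blast
      then have "x \<in> V C i" using \<open>x \<in> C\<close> by (auto simp: V_def)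
      then show "x \<in> (\<Union>i. V C i)" by blast
    qed
  qed (simp add: V_def U(2))
  have disj: "U i \<inter> A = {} \<or> U i \<inter> B = {}" for i
  proof (rule ccontr)
    assume "\<not> ?thesis"
    then obtain x y where xy: "x \<in> U i" "x \<in> A" "y \<in> U i" "y \<in> B" by blast
    have "ennreal (dist x y) \<le> ennreal \<delta>"
      using dist_le_ediameter[OF xy(1,3)] U(2)[of i] by (rule order_trans)
    moreover have "dist x y > \<delta>" using sep[OF xy(2,4)] \<open>\<delta> < d\<close> by auto
    ultimately show False
      using \<open>0 < \<delta>\<close> by (simp add: ennreal_le_iff2)
  qed
  have "hausdorff_content \<delta> A + hausdorff_content \<delta> B \<le>
        (\<Sum>i. ennreal (pi / 4) * ediameter (V A i) ^ 2) + (\<Sum>i. ennreal (pi / 4) * ediameter (V B i) ^ 2)"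
    by (intro add_mono V) auto
  also have "\<dots> = (\<Sum>i. ennreal (pi / 4) * ediameter (V A i) ^ 2 + ennreal (pi / 4) * ediameter (V B i) ^ 2)"
    by (rule suminf_add) auto
  also have "\<dots> \<le> (\<Sum>i. ennreal (pi / 4) * ediameter (U i) ^ 2)"
  proof (intro suminf_le)
    fix i show "ennreal (pi / 4) * ediameter (V A i) ^ 2 + ennreal (pi / 4) * ediameter (V B i) ^ 2
      \<le> ennreal (pi / 4) * ediameter (U i) ^ 2"
      using disj[of i] by (auto simp: V_def)
  qed auto
  finally show "hausdorff_content \<delta> A + hausdorff_content \<delta> B \<le> \<dots>" .
qed

lemma hausdorff2_separated:
  assumes "0 < d" and sep: "\<And>x y. x \<in> A \<Longrightarrow> y \<in> B \<Longrightarrow> d \<le> dist x y"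
  shows "hausdorff2 A + hausdorff2 B \<le> hausdorff2 (A \<union> B)"
proof -
  have *: "hausdorff_content \<delta> A + hausdorff_content \<delta>' B \<le> hausdorff2 (A \<union> B)" if "0 < \<delta>" "0 < \<delta>'" for \<delta> \<delta>'
  proof -
    define \<eta> where "\<eta> = min (min \<delta> \<delta>') (d / 2)"
    have \<eta>: "0 < \<eta>" "\<eta> < d" "\<eta> \<le> \<delta>" "\<eta> \<le> \<delta>'" using that \<open>0 < d\<close> by (auto simp: \<eta>_def)
    have "hausdorff_content \<delta> A + hausdorff_content \<delta>' B \<le> hausdorff_content \<eta> A + hausdorff_content \<eta> B"
      by (intro add_mono hausdorff_content_antimono \<eta>)
    also have "\<dots> \<le> hausdorff_content \<eta> (A \<union> B)"
      using \<eta>(1,2) sep by (rule hausdorff_content_separated)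
    also have "\<dots> \<le> hausdorff2 (A \<union> B)"
      using \<eta>(1) by (rule hausdorff_content_le_hausdorff2)
    finally show ?thesis .
  qed
  have ne: "{0::real<..} \<noteq> {}" by (simp add: exI)
  have "hausdorff2 A + hausdorff2 B = (SUP \<delta>\<in>{0<..}. hausdorff_content \<delta> A + hausdorff2 B)"
    unfolding hausdorff2_eq_SUP_content[of A] by (rule ennreal_SUP_add_left[OF ne, symmetric])
  also have "\<dots> = (SUP \<delta>\<in>{0<..}. SUP \<delta>'\<in>{0<..}. hausdorff_content \<delta>' B + hausdorff_content \<delta> A)"
    unfolding hausdorff2_eq_SUP_content[of B]
    by (subst ennreal_SUP_add_left[OF ne]) (simp add: add.commute)
  also have "\<dots> \<le> hausdorff2 (A \<union> B)"
    by (intro SUP_least) (use * in \<open>auto simp: add.commute\<close>)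
  finally show ?thesis .
qed

lemma hausdorff2_separated_sum:
  fixes A :: "nat \<Rightarrow> 'a::metric_space set"
  assumes "\<And>m n. m < n \<Longrightarrow> \<exists>d>0. \<forall>x\<in>A m. \<forall>y\<in>A n. d \<le> dist x y"
  shows "(\<Sum>m<n. hausdorff2 (A m)) \<le> hausdorff2 (\<Union>m<n. A m)"
proof (induction n)
  case (Suc n)
  have "\<exists>d>0. \<forall>m<k. \<forall>x\<in>A m. \<forall>y\<in>A n. d \<le> dist x y" if "k \<le> n" for k
    using that
  proof (induction k)
    case (Suc k)
    then obtain d d' where "d > 0" "\<forall>m<k. \<forall>x\<in>A m. \<forall>y\<in>A n. d \<le> dist x y"
      "d' > 0" "\<forall>x\<in>A k. \<forall>y\<in>A n. d' \<le> dist x y"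
      using assms[of k n] by auto
    then show ?case
      by (intro exI[of _ "min d d'"]) (auto simp: less_Suc_eq min_le_iff_disj)
  qed (auto intro: exI[of _ 1])
  then obtain d where d: "d > 0" "\<forall>m<n. \<forall>x\<in>A m. \<forall>y\<in>A n. d \<le> dist x y" by blast
  have "(\<Sum>m<Suc n. hausdorff2 (A m)) \<le> hausdorff2 (\<Union>m<n. A m) + hausdorff2 (A n)"
    using Suc.IH by (simp add: add_right_mono)
  also have "\<dots> \<le> hausdorff2 ((\<Union>m<n. A m) \<union> A n)"
    by (rule hausdorff2_separated[OF d(1)]) (use d(2) in auto)
  finally show ?case by (simp add: lessThan_Suc Un_commute)
qed simp

text \<open>
  Caratheodory's criterion. The part \<open>S n\<close> of \<open>T\<close> at distance at least \<open>1 / (n + 1)\<close> from \<open>F\<close> is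
  separated from \<open>F\<close>, so additivity holds for \<open>T \<inter> F\<close> and \<open>S n\<close>; it remains to see that passing from
  \<open>S n\<close> to \<open>T - F\<close> costs nothing in the limit. What is missing consists of the shells \<open>R m\<close> with
  \<open>m \<ge> n\<close>. Two shells whose indices differ by at least two are separated; hence the measures of the
  even shells, and those of the odd shells, sum to at most the measure of \<open>T\<close>, and the tail of
  the sum over all shells tends to zero when the measure of \<open>T\<close> is finite.
\<close>

lemma hausdorff2_closed_Caratheodory:
  fixes F T :: "'a::metric_space set"
  assumes "closed F"
  shows "hausdorff2 (T \<inter> F) + hausdorff2 (T - F) \<le> hausdorff2 T"
proof (cases "F = {} \<or> hausdorff2 T = top")
  case True
  then show ?thesis by auto
next
  case False
  then have F: "F \<noteq> {}" and fin: "hausdorff2 T \<noteq> top" by auto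
  define S where "S n = {x \<in> T. 1 / real (Suc n) \<le> infdist x F}" for n
  define R where "R n = {x \<in> T. 1 / real (Suc (Suc n)) \<le> infdist x F \<and> infdist x F < 1 / real (Suc n)}" for n
  have far: "d \<le> dist x y" if "infdist x F + d \<le> infdist y F" for x y d
    using infdist_triangle[of y F x] that by (simp add: dist_commute)
  have sepR: "\<exists>d>0. \<forall>x\<in>R m. \<forall>y\<in>R n. d \<le> dist x y" if "Suc m < n" for m n
  proof -
    define d where "d = 1 / real (Suc (Suc m)) - 1 / real (Suc n)"
    have "d > 0" using that by (simp add: d_def frac_less2)
    moreover have "d \<le> dist x y" if "x \<in> R m" "y \<in> R n" for x y
    proof -
      have "infdist y F + d \<le> infdist x F" using that by (simp add: R_def d_def)
      then show ?thesis using far[of y d x] by (simp add: dist_commute)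
    qed
    ultimately show ?thesis by blast
  qed
  \<comment> \<open>Used for \<open>c = 0\<close>, the shells of even index, and for \<open>c = 1\<close>, those of odd index.\<close>
  have part: "(\<Sum>m<n. hausdorff2 (R (2 * m + c))) \<le> hausdorff2 T" for n c
  proof -
    have "(\<Sum>m<n. hausdorff2 (R (2 * m + c))) \<le> hausdorff2 (\<Union>m<n. R (2 * m + c))"
      by (rule hausdorff2_separated_sum) (auto intro!: sepR)
    also have "\<dots> \<le> hausdorff2 T"
      by (rule hausdorff2_mono) (auto simp: R_def)
    finally show ?thesis .
  qed
  have "(\<Sum>m<n. hausdorff2 (R m)) \<le> hausdorff2 T + hausdorff2 T" for n
  proof -
    have "(\<Sum>m<n. hausdorff2 (R m)) \<le> (\<Sum>m<2 * n. hausdorff2 (R m))"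
      by (rule sum_mono2) auto
    also have "\<dots> = (\<Sum>m<n. hausdorff2 (R (2 * m + 0))) + (\<Sum>m<n. hausdorff2 (R (2 * m + 1)))"
      by (induction n) (auto simp: algebra_simps)
    also have "\<dots> \<le> hausdorff2 T + hausdorff2 T"
      by (intro add_mono part)
    finally show ?thesis .
  qed
  then have "(\<Sum>m. hausdorff2 (R m)) \<le> hausdorff2 T + hausdorff2 T"
    by (intro suminf_le_const) auto
  also have "\<dots> < top" using fin by (simp add: less_top)
  finally have sumR: "(\<Sum>m. hausdorff2 (R m)) < top" .
  have tail: "(\<lambda>n. (\<Sum>m. hausdorff2 (R (m + n)))) \<longlonglongrightarrow> 0"
  proof -
    define h where "h m = enn2real (hausdorff2 (R m))" for m
    have "hausdorff2 (R m) < top" for m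
      using order_le_less_trans[OF ennreal_le_suminf sumR] .
    then have h: "hausdorff2 (R m) = ennreal (h m)" for m
      by (simp add: h_def)
    have h0: "0 \<le> h m" for m by (simp add: h_def)
    have sh: "summable h"
      using sumR by (intro summable_suminf_not_top) (auto simp: h h0)
    have "(\<Sum>m. hausdorff2 (R (m + n))) = ennreal (\<Sum>m. h (m + n))" for n
      unfolding h by (intro suminf_ennreal2 h0) (simp add: sh)
    moreover have "(\<lambda>n. \<Sum>m. h (m + n)) \<longlonglongrightarrow> 0"
      using suminf_exist_split[OF _ sh] by (auto simp: LIMSEQ_iff)
    then have "(\<lambda>n. ennreal (\<Sum>m. h (m + n))) \<longlonglongrightarrow> ennreal 0"
      by (rule tendsto_ennrealI)
    ultimately show ?thesis by simp
  qed
  have split: "T - F \<subseteq> S n \<union> (\<Union>m. R (m + n))" for n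
  proof
    fix x assume x: "x \<in> T - F"
    then have pos: "infdist x F > 0"
      using \<open>closed F\<close> F by (simp add: infdist_pos_not_in_closed)
    show "x \<in> S n \<union> (\<Union>m. R (m + n))"
    proof (cases "x \<in> S n")
      case False
      \<comment> \<open>The first threshold that the distance of \<open>x\<close> to \<open>F\<close> reaches: \<open>x\<close> lies in shell \<open>k - 1\<close>.\<close>
      define k where "k = (LEAST k. 1 / real (Suc k) \<le> infdist x F)"
      obtain k0 where "1 / real (Suc k0) \<le> infdist x F"
        using pos by (metis reals_Archimedean inverse_eq_divide less_imp_le)
      then have k: "1 / real (Suc k) \<le> infdist x F"
        unfolding k_def by (rule LeastI)
      have "n < k"
      proof (rule ccontr)
        assume "\<not> n < k"
        then have "1 / real (Suc n) \<le> 1 / real (Suc k)" by (simp add: frac_le)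
        with k False x show False by (auto simp: S_def)
      qed
      then obtain j where j: "k = Suc j" "n \<le> j" by (cases k) auto
      have "infdist x F < 1 / real (Suc j)"
        using not_less_Least[of j "\<lambda>k. 1 / real (Suc k) \<le> infdist x F"] j(1) k_def by auto
      then have "x \<in> R ((j - n) + n)"
        using k x j by (auto simp: R_def)
      then show ?thesis by blast
    qed simp
  qed
  have bound: "hausdorff2 (T \<inter> F) + hausdorff2 (T - F) \<le> hausdorff2 T + (\<Sum>m. hausdorff2 (R (m + n)))" for n
  proof -
    have "hausdorff2 (T - F) \<le> hausdorff2 (S n) + hausdorff2 (\<Union>m. R (m + n))"
      using hausdorff2_mono[OF split] hausdorff2_Un_le by (rule order_trans)
    also have "\<dots> \<le> hausdorff2 (S n) + (\<Sum>m. hausdorff2 (R (m + n)))"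
      by (intro add_left_mono hausdorff2_countable_subadditive)
    finally have "hausdorff2 (T \<inter> F) + hausdorff2 (T - F) \<le>
        (hausdorff2 (T \<inter> F) + hausdorff2 (S n)) + (\<Sum>m. hausdorff2 (R (m + n)))"
      by (simp add: add.assoc add_left_mono)
    also have "hausdorff2 (T \<inter> F) + hausdorff2 (S n) \<le> hausdorff2 (T \<inter> F \<union> S n)"
      by (rule hausdorff2_separated[of "1 / real (Suc n)"]) (auto simp: S_def intro: far)
    also have "\<dots> \<le> hausdorff2 T" by (rule hausdorff2_mono) (auto simp: S_def)
    finally show ?thesis by (simp add: add_right_mono)
  qed
  have "(\<lambda>n. hausdorff2 T + (\<Sum>m. hausdorff2 (R (m + n)))) \<longlonglongrightarrow> hausdorff2 T + 0"
    by (intro tendsto_add tendsto_const tail)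
  then show ?thesis
    using bound by (intro LIMSEQ_le_const[of _ "hausdorff2 T"]) auto
qed

lemma measure_space_hausdorff2_borel:
  "measure_space UNIV (sets (borel :: 'a::metric_space measure)) hausdorff2"
proof -
  interpret P: sigma_algebra "UNIV :: 'a set" UNIV
    using sigma_algebra_Pow[of "UNIV :: 'a set"] by simp
  have "outer_measure_space (UNIV :: 'a set set) hausdorff2"
    unfolding outer_measure_space_def positive_def increasing_def countably_subadditive_def
    by (auto intro: hausdorff2_mono hausdorff2_countable_subadditive)
  note ms = P.caratheodory_lemma[OF this]
  define L where "L = lambda_system (UNIV :: 'a set) UNIV hausdorff2"
  have msL: "measure_space UNIV L hausdorff2" using ms by (simp add: L_def)
  then have sL: "sigma_algebra UNIV L" by (simp add: measure_space_def)
  have "F \<in> L" if "closed F" for F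
  proof -
    have "hausdorff2 (F \<inter> T) + hausdorff2 ((UNIV - F) \<inter> T) = hausdorff2 T" for T
    proof (rule antisym)
      show "hausdorff2 (F \<inter> T) + hausdorff2 ((UNIV - F) \<inter> T) \<le> hausdorff2 T"
        using hausdorff2_closed_Caratheodory[OF that, of T]
        by (simp add: Int_commute Diff_eq)
      have "T = (F \<inter> T) \<union> ((UNIV - F) \<inter> T)" by blast
      then show "hausdorff2 T \<le> hausdorff2 (F \<inter> T) + hausdorff2 ((UNIV - F) \<inter> T)"
        using hausdorff2_Un_le[of "F \<inter> T" "(UNIV - F) \<inter> T"] by simp
    qed
    then show ?thesis by (simp add: L_def lambda_system_def)
  qed
  then have "sets borel \<subseteq> L"
    unfolding borel_eq_closed using sigma_algebra.sigma_sets_subset[OF sL, of "Collect closed"] by auto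
  then show ?thesis
    using msL sets.sigma_algebra_axioms[of borel]
    unfolding measure_space_def positive_def countably_additive_def by (auto simp: space_borel)
qed

lemma
  fixes Z :: "'a::metric_space set"
  shows space_hausdorff2_measure: "space (hausdorff2_measure Z) = Z"
    and sets_hausdorff2_measure: "sets (hausdorff2_measure Z) = sets (restrict_space borel Z)"
proof -
  have "sets (restrict_space borel Z) \<subseteq> Pow Z"
    by (auto simp: sets_restrict_space)
  then show "space (hausdorff2_measure Z) = Z"
    "sets (hausdorff2_measure Z) = sets (restrict_space borel Z)"
    unfolding hausdorff2_measure_def
    using sets.sigma_sets_eq[of "restrict_space borel Z"]
    by (simp_all add: space_measure_of sets_measure_of space_restrict_space)
qed

text \<open>
  Outside the \<open>\<sigma>\<close>-algebra the measure is zero by convention, hence an inequality for all sets.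
\<close>

lemma emeasure_hausdorff2_measure_le: "emeasure (hausdorff2_measure Z) A \<le> hausdorff2 A"
  unfolding hausdorff2_measure_def emeasure_measure_of_conv by simp

lemma emeasure_hausdorff2_measure:
  assumes "Z \<in> sets borel" "A \<in> sets borel" "A \<subseteq> Z"
  shows "emeasure (hausdorff2_measure Z) A = hausdorff2 A"
proof -
  have sub: "sets (restrict_space borel Z) \<subseteq> sets borel"
    using assms(1) by (auto simp: sets_restrict_space)
  have A: "A \<in> sets (restrict_space borel Z)"
    using assms by (auto simp: sets_restrict_space_iff)
  have ss: "sigma_sets Z (sets (restrict_space borel Z)) = sets (restrict_space borel Z)"
    using sets.sigma_sets_eq[of "restrict_space borel Z"] by (simp add: space_restrict_space)
  have "measure_space Z (sets (restrict_space borel Z)) hausdorff2"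
    using measure_space_hausdorff2_borel sub sets.sigma_algebra_axioms[of "restrict_space borel Z"]
    unfolding measure_space_def positive_def countably_additive_def
    by (auto simp: space_restrict_space)
  then show ?thesis
    unfolding hausdorff2_measure_def emeasure_measure_of_conv ss using A by simp
qed

section \<open>Comparison with Lebesgue measure\<close>

text \<open>
  If \<open>T\<close> does not shrink differences of coordinates, then the preimage of a set of diameter \<open>d\<close> lies
  in a square of side \<open>2 * d\<close>, whose area is \<open>4 * d\<^sup>2 = 16 / pi * (pi / 4 * d\<^sup>2)\<close>. This crude comparison
  replaces the equality of Lebesgue and Hausdorff measure: the modulus argument only asks
  whether certain integrals are infinite.
\<close>

lemma emeasure_vimage_le_hausdorff2:
  fixes T :: "real \<times> real \<Rightarrow> 'a::metric_space"
  assumes coord: "\<And>p q. \<bar>fst p - fst q\<bar> \<le> dist (T p) (T q)" "\<And>p q. \<bar>snd p - snd q\<bar> \<le> dist (T p) (T q)"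
  shows "emeasure (lborel \<Otimes>\<^sub>M lborel) (T -` C) \<le> ennreal (16 / pi) * hausdorff2 C"
proof -
  let ?M = "lborel \<Otimes>\<^sub>M lborel :: (real \<times> real) measure"
  have "emeasure ?M (T -` C) \<le> ennreal (16 / pi) * (\<Sum>i. ennreal (pi / 4) * ediameter (U i) ^ 2)"
    \<comment> \<open>Covers at the single scale 1 give the estimate; the bound makes their diameters finite.\<close>
    if U: "C \<subseteq> (\<Union>i. U i)" "\<And>i. ediameter (U i) \<le> ennreal 1" for U :: "nat \<Rightarrow> 'a set"
  proof -
    have "\<exists>B. T -` U i \<subseteq> B \<and> B \<in> sets ?M \<and> emeasure ?M B \<le> 4 * ediameter (U i) ^ 2" for i
    proof (cases "T -` U i = {}")
      case False
      then obtain p where p: "T p \<in> U i" by blast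
      have "ediameter (U i) < top" using U(2)[of i] by (simp add: order_le_less_trans)
      then obtain d where d: "0 \<le> d" "ediameter (U i) = ennreal d"
        by (cases "ediameter (U i)") auto
      define B where "B = {fst p - d..fst p + d} \<times> {snd p - d..snd p + d}"
      have "T -` U i \<subseteq> B"
      proof
        fix q assume "q \<in> T -` U i"
        then have "ennreal (dist (T p) (T q)) \<le> ennreal d"
          using dist_le_ediameter[of "T p" "U i" "T q"] p d by simp
        then have "dist (T p) (T q) \<le> d" using d(1) by simp
        then show "q \<in> B" using coord[of p q] by (cases q) (auto simp: B_def abs_le_iff)
      qed
      moreover have "emeasure ?M B = ennreal (2 * d) * ennreal (2 * d)"
        unfolding B_def using d(1) by (subst lborel.emeasure_pair_measure_Times) auto
      moreover have "\<dots> = 4 * ediameter (U i) ^ 2"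
        using d by (simp add: power2_eq_square ennreal_mult[symmetric] ennreal_numeral[symmetric] del: ennreal_numeral)
      ultimately show ?thesis by (intro exI[of _ B]) (auto simp: B_def)
    qed (auto intro!: exI[of _ "{}"])
    then obtain B where B: "\<And>i. T -` U i \<subseteq> B i" "\<And>i. B i \<in> sets ?M"
      "\<And>i. emeasure ?M (B i) \<le> 4 * ediameter (U i) ^ 2" by metis
    have "emeasure ?M (T -` C) \<le> emeasure ?M (\<Union>i. B i)"
      using U(1) B(1,2) by (intro emeasure_mono) (auto, blast)
    also have "\<dots> \<le> (\<Sum>i. emeasure ?M (B i))"
      using B(2) by (intro emeasure_subadditive_countably) auto
    also have "\<dots> \<le> (\<Sum>i. ennreal (16 / pi) * (ennreal (pi / 4) * ediameter (U i) ^ 2))"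
    proof (intro suminf_le)
      fix i
      have "ennreal (16 / pi) * (ennreal (pi / 4) * ediameter (U i) ^ 2) = ennreal (16 / pi * (pi / 4)) * ediameter (U i) ^ 2"
        by (subst ennreal_mult) (auto simp: mult.assoc)
      also have "16 / pi * (pi / 4) = 4" by simp
      finally show "emeasure ?M (B i) \<le> ennreal (16 / pi) * (ennreal (pi / 4) * ediameter (U i) ^ 2)"
        using B(3)[of i] by simp
    qed auto
    finally show ?thesis by simp
  qed
  then have "emeasure ?M (T -` C) / ennreal (16 / pi) \<le> hausdorff_content 1 C"
    unfolding hausdorff_content_def by (intro INF_greatest divide_le_posI_ennreal) auto
  then have "ennreal (16 / pi) * (emeasure ?M (T -` C) / ennreal (16 / pi)) \<le> ennreal (16 / pi) * hausdorff_content 1 C"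
    by (rule mult_left_mono) simp
  moreover have "ennreal (16 / pi) * (emeasure ?M (T -` C) / ennreal (16 / pi)) = emeasure ?M (T -` C)"
    unfolding ennreal_times_divide mult.commute[of "ennreal (16 / pi)"]
    by (rule mult_divide_eq_ennreal) auto
  ultimately have "emeasure ?M (T -` C) \<le> ennreal (16 / pi) * hausdorff_content 1 C"
    by simp
  also have "\<dots> \<le> ennreal (16 / pi) * hausdorff2 C"
    by (intro mult_left_mono hausdorff_content_le_hausdorff2) auto
  finally show ?thesis .
qed

lemma nn_integral_le_hausdorff2_measure:
  fixes T :: "real \<times> real \<Rightarrow> 'a::metric_space"
  assumes coord: "\<And>p q. \<bar>fst p - fst q\<bar> \<le> dist (T p) (T q)" "\<And>p q. \<bar>snd p - snd q\<bar> \<le> dist (T p) (T q)"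
    and T[measurable]: "T \<in> borel_measurable (lborel \<Otimes>\<^sub>M lborel)"
    and Z: "Z \<in> sets borel" and f: "f \<in> borel_measurable (restrict_space borel Z)"
  shows "(\<integral>\<^sup>+p. f (T p) * indicator Z (T p) \<partial>(lborel \<Otimes>\<^sub>M lborel))
    \<le> ennreal (16 / pi) * (\<integral>\<^sup>+z. f z \<partial>hausdorff2_measure Z)"
proof -
  let ?D = "distr (lborel \<Otimes>\<^sub>M lborel) borel T"
  let ?N = "restrict_space ?D Z"
  have meas: "(\<lambda>z. f z * indicator Z z) \<in> borel_measurable borel"
    using f Z by (simp add: borel_measurable_restrict_space_iff_ennreal)
  have sN: "sets ?N = sets (restrict_space borel Z)"
    by (rule sets_restrict_space_cong) simp
  have "(\<integral>\<^sup>+p. f (T p) * indicator Z (T p) \<partial>(lborel \<Otimes>\<^sub>M lborel)) = (\<integral>\<^sup>+z. f z * indicator Z z \<partial>?D)"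
    using meas by (subst nn_integral_distr) auto
  also have "\<dots> = (\<integral>\<^sup>+z. f z \<partial>?N)"
    using Z by (subst nn_integral_restrict_space) auto
  also have "\<dots> \<le> (\<integral>\<^sup>+z. f z \<partial>scale_measure (ennreal (16 / pi)) (hausdorff2_measure Z))"
  proof (rule nn_integral_mono_measure)
    show s: "sets ?N = sets (scale_measure (ennreal (16 / pi)) (hausdorff2_measure Z))"
      by (simp add: sN sets_hausdorff2_measure)
    show "?N \<le> scale_measure (ennreal (16 / pi)) (hausdorff2_measure Z)"
      unfolding le_measure[OF s]
    proof
      fix A assume "A \<in> sets ?N"
      then have A: "A \<in> sets borel" "A \<subseteq> Z"
        using Z by (auto simp: sN sets_restrict_space_iff)
      have "emeasure ?N A = emeasure (lborel \<Otimes>\<^sub>M lborel) (T -` A)"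
        using A Z by (subst emeasure_restrict_space) (auto simp: emeasure_distr space_pair_measure)
      also have "\<dots> \<le> ennreal (16 / pi) * hausdorff2 A"
        by (rule emeasure_vimage_le_hausdorff2[OF coord])
      finally show "emeasure ?N A \<le> emeasure (scale_measure (ennreal (16 / pi)) (hausdorff2_measure Z)) A"
        using A Z by (simp add: emeasure_hausdorff2_measure)
    qed
  qed
  also have "\<dots> = ennreal (16 / pi) * (\<integral>\<^sup>+z. f z \<partial>hausdorff2_measure Z)"
    using f by (intro nn_integral_scale_measure) (simp cong: measurable_cong_sets add: sets_hausdorff2_measure)
  finally show ?thesis .
qed

section \<open>Path integrals along segments\<close>

lemma curve_length_linepath:
  fixes a b :: "'a::real_normed_vector"
  assumes "0 \<le> u"
  shows "curve_length (linepath a b) 0 u = ennreal (u * dist a b)"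
  unfolding curve_length_def
proof (rule antisym)
  have lin: "dist (linepath a b s) (linepath a b t) = (t - s) * dist a b" if "s \<le> t" for s t
  proof -
    have "linepath a b s - linepath a b t = (t - s) *\<^sub>R (a - b)"
      by (simp add: linepath_def algebra_simps)
    then show ?thesis using that by (simp add: dist_norm)
  qed
  show "Sup {(\<Sum>i<n. ennreal (dist (linepath a b (t i)) (linepath a b (t (Suc i))))) | (n::nat) (t :: nat \<Rightarrow> real).
      (\<forall>i\<le>n. t i \<in> {0..u}) \<and> (\<forall>i<n. t i \<le> t (Suc i))} \<le> ennreal (u * dist a b)"
  proof (rule Sup_least, clarify)
    fix n :: nat and t :: "nat \<Rightarrow> real"
    assume t: "\<forall>i\<le>n. t i \<in> {0..u}" "\<forall>i<n. t i \<le> t (Suc i)"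
    have "(\<Sum>i<n. ennreal (dist (linepath a b (t i)) (linepath a b (t (Suc i))))) =
        ennreal (\<Sum>i<n. (t (Suc i) - t i) * dist a b)"
      using t(2) by (subst sum_ennreal[symmetric]) (auto simp: lin)
    also have "(\<Sum>i<n. (t (Suc i) - t i) * dist a b) = (t n - t 0) * dist a b"
      by (simp add: sum_distrib_right[symmetric] sum_lessThan_telescope)
    also have "\<dots> \<le> u * dist a b"
    proof (rule mult_right_mono)
      have "0 \<le> t 0" "t n \<le> u" using t(1) by auto
      then show "t n - t 0 \<le> u" by linarith
    qed simp
    finally show "(\<Sum>i<n. ennreal (dist (linepath a b (t i)) (linepath a b (t (Suc i))))) \<le> ennreal (u * dist a b)"
      by (simp add: ennreal_leI)
  qed
  show "ennreal (u * dist a b) \<le> Sup {(\<Sum>i<n. ennreal (dist (linepath a b (t i)) (linepath a b (t (Suc i))))) | (n::nat) (t :: nat \<Rightarrow> real).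
      (\<forall>i\<le>n. t i \<in> {0..u}) \<and> (\<forall>i<n. t i \<le> t (Suc i))}"
    using \<open>0 \<le> u\<close>
    by (intro Sup_upper CollectI exI[of _ 1] exI[of _ "\<lambda>i. if i = 0 then 0 else u"]) (auto simp: lin)
qed

lemma arclength_param_linepath:
  fixes a b :: "'a::real_normed_vector"
  assumes "a \<noteq> b" "s \<in> {0..dist a b}"
  shows "arclength_param (linepath a b) s = linepath a b (s / dist a b)"
proof -
  have "(SOME u. u \<in> {0..1} \<and> curve_length (linepath a b) 0 u = ennreal s) = s / dist a b"
  proof (rule some_equality)
    show "s / dist a b \<in> {0..1} \<and> curve_length (linepath a b) 0 (s / dist a b) = ennreal s"
      using assms by (auto simp: curve_length_linepath)
    fix u assume "u \<in> {0..1} \<and> curve_length (linepath a b) 0 u = ennreal s"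
    then show "u = s / dist a b"
      using assms by (auto simp: curve_length_linepath field_simps)
  qed
  then show ?thesis by (simp add: arclength_param_def)
qed

lemma path_length_linepath: "path_length (linepath a b) = ennreal (dist a b)"
  by (simp add: path_length_def curve_length_linepath)

lemma rectifiable_linepath: "rectifiable (linepath a b)"
  by (simp add: rectifiable_def path_length_linepath)

lemma path_integral_segment:
  fixes c v :: "'a::real_normed_vector"
  assumes "t1 < t2" "v \<noteq> 0"
    and [measurable]: "(\<lambda>t. \<rho> (c + t *\<^sub>R v) * indicator {t1..t2} t) \<in> borel_measurable borel"
  shows "path_integral \<rho> (linepath (c + t1 *\<^sub>R v) (c + t2 *\<^sub>R v)) =
    ennreal (norm v) * (\<integral>\<^sup>+t. \<rho> (c + t *\<^sub>R v) * indicator {t1..t2} t \<partial>lborel)"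
proof -
  define L where "L = dist (c + t1 *\<^sub>R v) (c + t2 *\<^sub>R v)"
  have "(c + t1 *\<^sub>R v) - (c + t2 *\<^sub>R v) = (t1 - t2) *\<^sub>R v" by (simp add: algebra_simps)
  then have L: "L = (t2 - t1) * norm v" using assms(1) by (simp add: L_def dist_norm)
  have ne: "c + t1 *\<^sub>R v \<noteq> c + t2 *\<^sub>R v" using assms by simp
  have nv: "0 < norm v" using assms by simp
  let ?f = "\<lambda>t. \<rho> (c + t *\<^sub>R v) * indicator {t1..t2} t"
  have "path_integral \<rho> (linepath (c + t1 *\<^sub>R v) (c + t2 *\<^sub>R v)) =
      (\<integral>\<^sup>+s. ?f (t1 + (1 / norm v) * s) \<partial>lborel)"
    unfolding path_integral_def path_length_linepath L_def[symmetric]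
  proof (rule nn_integral_cong)
    fix s :: real
    have "L \<ge> 0" by (simp add: L_def)
    show "\<rho> (arclength_param (linepath (c + t1 *\<^sub>R v) (c + t2 *\<^sub>R v)) s) * indicator {0..enn2real (ennreal L)} s =
        ?f (t1 + (1 / norm v) * s)"
    proof (cases "s \<in> {0..L}")
      case True
      have "linepath (c + t1 *\<^sub>R v) (c + t2 *\<^sub>R v) u = c + (t1 + u * (t2 - t1)) *\<^sub>R v" for u
        by (simp add: linepath_def algebra_simps)
      then have "linepath (c + t1 *\<^sub>R v) (c + t2 *\<^sub>R v) (s / L) = c + (t1 + (s / L) * (t2 - t1)) *\<^sub>R v" .
      also have "(s / L) * (t2 - t1) = (1 / norm v) * s"
        using assms(1) nv by (simp add: L)
      finally have "arclength_param (linepath (c + t1 *\<^sub>R v) (c + t2 *\<^sub>R v)) s = c + (t1 + (1 / norm v) * s) *\<^sub>R v"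
        using arclength_param_linepath[OF ne] True by (simp add: L_def)
      moreover have "t1 + (1 / norm v) * s \<in> {t1..t2}"
        using True nv by (auto simp: L field_simps)
      ultimately show ?thesis using True \<open>L \<ge> 0\<close> by simp
    next
      case False
      then have "t1 + (1 / norm v) * s \<notin> {t1..t2}"
        using nv by (auto simp: L field_simps zero_le_mult_iff)
      then show ?thesis using False \<open>L \<ge> 0\<close> by simp
    qed
  qed
  moreover have "(\<integral>\<^sup>+t. ?f t \<partial>lborel) = ennreal (1 / norm v) * (\<integral>\<^sup>+s. ?f (t1 + (1 / norm v) * s) \<partial>lborel)"
    using nn_integral_real_affine[of ?f "1 / norm v" t1] nv assms by simp
  ultimately show ?thesis
    using nv by (simp add: mult.assoc[symmetric] ennreal_mult[symmetric])
qed

section \<open>Modulus estimates\<close>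

text \<open>
  Every path of the family has length at least \<open>c\<close>, so the constant \<open>1 / c\<close> is admissible.
\<close>

lemma Modulus_le_if_endpoints_apart:
  fixes W :: "'a::metric_space set"
  assumes "0 < c" and apart: "\<And>\<gamma>. \<gamma> \<in> \<Gamma> \<Longrightarrow> c \<le> dist (\<gamma> 0) (\<gamma> 1)"
  shows "Modulus W \<Gamma> \<le> ennreal (1 / c) ^ 2 * hausdorff2 W"
proof -
  have "1 \<le> path_integral (\<lambda>_. ennreal (1 / c)) \<gamma>" if "\<gamma> \<in> \<Gamma>" "rectifiable \<gamma>" for \<gamma>
  proof -
    have "ennreal (dist (\<gamma> 0) (\<gamma> 1)) \<le> path_length \<gamma>"
      unfolding path_length_def curve_length_def
      by (intro Sup_upper CollectI exI[of _ 1] exI[of _ "\<lambda>i. if i = 0 then 0 else 1"]) auto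
    then have c: "ennreal c \<le> path_length \<gamma>"
      using apart[OF that(1)] by (meson ennreal_leI order_trans)
    have "1 = ennreal (1 / c) * ennreal c" using \<open>0 < c\<close> by (simp add: ennreal_mult[symmetric])
    also have "\<dots> \<le> ennreal (1 / c) * path_length \<gamma>"
      using c by (intro mult_left_mono) auto
    also have "\<dots> = path_integral (\<lambda>_. ennreal (1 / c)) \<gamma>"
      using that(2) unfolding rectifiable_def path_integral_def
      by (subst nn_integral_cmult_indicator) (auto simp: less_top)
    finally show ?thesis .
  qed
  then have "admissible W \<Gamma> (\<lambda>_. ennreal (1 / c))"
    by (simp add: admissible_def)
  then have "Modulus W \<Gamma> \<le> (\<integral>\<^sup>+z. ennreal (1 / c) ^ 2 \<partial>hausdorff2_measure W)"
    unfolding Modulus_def by (intro INF_lower) simp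
  also have "\<dots> \<le> ennreal (1 / c) ^ 2 * hausdorff2 W"
    using emeasure_hausdorff2_measure_le[of W W]
    by (simp add: space_hausdorff2_measure mult_left_mono)
  finally show ?thesis .
qed

text \<open>
  Coordinates adapted to a boundary point \<open>z\<close> of the unit disk. The chart is a similarity of ratio
  \<open>sqrt 2\<close> that sends the origin to \<open>z\<close> and the diagonal to the radius at \<open>z\<close>, pointing inwards. The disk
  becomes \<open>x\<^sup>2 + y\<^sup>2 < x + y\<close>, and its points with \<open>max x y = r\<close> form a crosscut around \<open>z\<close> that consists
  of two straight legs meeting on the radius. Compared with the usual crosscuts by circles around
  \<open>z\<close>, arc length along straight legs is immediate, and Tonelli's theorem in Cartesian coordinates
  takes the place of integration in polar coordinates.
\<close>

definition corner_chart :: "complex \<Rightarrow> real \<times> real \<Rightarrow> complex" where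
  "corner_chart z p = z * (1 - Complex (fst p + snd p) (snd p - fst p))"

lemma dist_corner_chart:
  assumes "norm z = 1"
  shows "dist (corner_chart z p) (corner_chart z q) = sqrt 2 * sqrt ((fst p - fst q)\<^sup>2 + (snd p - snd q)\<^sup>2)"
proof -
  have "corner_chart z p - corner_chart z q =
      z * (Complex (fst q + snd q) (snd q - fst q) - Complex (fst p + snd p) (snd p - fst p))"
    by (simp add: corner_chart_def algebra_simps)
  then have "dist (corner_chart z p) (corner_chart z q) = norm (Complex (fst q + snd q) (snd q - fst q) - Complex (fst p + snd p) (snd p - fst p))"
    using assms by (simp add: dist_norm norm_mult)
  also have "\<dots> = sqrt (2 * ((fst p - fst q)\<^sup>2 + (snd p - snd q)\<^sup>2))"
    by (simp add: cmod_def power2_eq_square algebra_simps)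
  finally show ?thesis by (simp only: real_sqrt_mult)
qed

lemma corner_chart_coordinate_le:
  assumes "norm z = 1"
  shows "\<bar>fst p - fst q\<bar> \<le> dist (corner_chart z p) (corner_chart z q)"
    and "\<bar>snd p - snd q\<bar> \<le> dist (corner_chart z p) (corner_chart z q)"
proof -
  let ?s = "sqrt ((fst p - fst q)\<^sup>2 + (snd p - snd q)\<^sup>2)"
  have "1 * ?s \<le> sqrt 2 * ?s" by (intro mult_right_mono) auto
  moreover have "\<bar>fst p - fst q\<bar> \<le> ?s" "\<bar>snd p - snd q\<bar> \<le> ?s"
    by (auto intro!: real_le_rsqrt)
  ultimately show "\<bar>fst p - fst q\<bar> \<le> dist (corner_chart z p) (corner_chart z q)"
    "\<bar>snd p - snd q\<bar> \<le> dist (corner_chart z p) (corner_chart z q)"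
    unfolding dist_corner_chart[OF assms] by linarith+
qed

lemma corner_chart_in_ball_iff:
  assumes "norm z = 1"
  shows "corner_chart z (x, y) \<in> ball 0 1 \<longleftrightarrow> x\<^sup>2 + y\<^sup>2 < x + y"
proof -
  have "norm (corner_chart z (x, y)) = sqrt ((1 - (x + y))\<^sup>2 + (y - x)\<^sup>2)"
    unfolding corner_chart_def norm_mult assms by (simp add: cmod_def power2_commute)
  also have "(1 - (x + y))\<^sup>2 + (y - x)\<^sup>2 = 1 + 2 * ((x\<^sup>2 + y\<^sup>2) - (x + y))"
    by (simp add: power2_eq_square algebra_simps)
  finally have "norm (corner_chart z (x, y)) = sqrt (1 + 2 * ((x\<^sup>2 + y\<^sup>2) - (x + y)))" .
  moreover have "1 + 2 * (a - b) < 1 \<longleftrightarrow> a < b" for a b :: real by auto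
  ultimately show ?thesis by (simp only: mem_ball_0 real_sqrt_lt_1_iff)
qed

text \<open>
  Within the disk, a leg at height \<open>r\<close> only uses parameters in \<open>{- r..r}\<close>: its length is at most a
  constant times \<open>r\<close>.
\<close>

lemma leg_coordinate_bound:
  fixes r t :: real
  assumes "r\<^sup>2 + t\<^sup>2 < r + t" "t \<le> r"
  shows "- r \<le> t"
proof (rule ccontr)
  assume "\<not> - r \<le> t"
  then have "r + t < 0" by simp
  then show False using assms(1) sum_power2_ge_zero[of r t] by linarith
qed

lemma corner_chart_legs:
  "corner_chart z (r, t) = z * Complex (1 - r) r + t *\<^sub>R (z * Complex (-1) (-1))"
  "corner_chart z (t, r) = z * Complex (1 - r) (- r) + t *\<^sub>R (z * Complex (-1) 1)"
  by (simp_all add: corner_chart_def complex_eq_iff algebra_simps)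

text \<open>
  By the Cauchy-Schwarz inequality, the squared integral of \<open>G\<close> over an interval of length at most
  \<open>2 * r\<close> is at most \<open>2 * r\<close> times the integral of \<open>G\<^sup>2\<close>. The factor \<open>sqrt 2\<close> is the speed of the legs.
\<close>

lemma length_area_step:
  fixes G :: "real \<Rightarrow> ennreal"
  assumes [measurable]: "G \<in> borel_measurable borel" and "0 < r" "-r \<le> t1" "t2 \<le> r"
    and one: "1 \<le> ennreal (sqrt 2) * (\<integral>\<^sup>+t. G t * indicator {t1..t2} t \<partial>lborel)"
  shows "ennreal (1 / (4 * r)) \<le> (\<integral>\<^sup>+t. G t ^ 2 \<partial>lborel)"
proof -
  have "1 \<le> (ennreal (sqrt 2) * (\<integral>\<^sup>+t. G t * indicator {t1..t2} t \<partial>lborel))\<^sup>2"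
    using one by (metis one_power2 power_mono zero_le)
  also have "\<dots> = 2 * (\<integral>\<^sup>+t. G t * indicator {t1..t2} t \<partial>lborel)\<^sup>2"
    by (simp add: power_mult_distrib ennreal_power)
  also have "\<dots> \<le> 2 * ((\<integral>\<^sup>+t. G t ^ 2 \<partial>lborel) * (\<integral>\<^sup>+t. indicator {t1..t2} t ^ 2 \<partial>lborel))"
    by (intro mult_left_mono Cauchy_Schwarz_nn_integral) auto
  also have "(\<integral>\<^sup>+t. (indicator {t1..t2} t :: ennreal) ^ 2 \<partial>lborel) = emeasure lborel {t1..t2}"
  proof -
    have "(indicator {t1..t2} t :: ennreal) ^ 2 = indicator {t1..t2} t" for t :: real
      by (simp add: indicator_def)
    then show ?thesis by simp
  qed
  also have "\<dots> \<le> ennreal (2 * r)"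
    using assms(2-4) by (cases "t1 \<le> t2") (auto intro: ennreal_leI)
  finally have "1 \<le> 2 * ((\<integral>\<^sup>+t. G t ^ 2 \<partial>lborel) * ennreal (2 * r))"
    by (simp add: mult_left_mono)
  then have "ennreal (1 / (4 * r)) * 1 \<le> ennreal (1 / (4 * r)) * (2 * ((\<integral>\<^sup>+t. G t ^ 2 \<partial>lborel) * ennreal (2 * r)))"
    by (rule mult_left_mono) simp
  also have "\<dots> = (ennreal (1 / (4 * r)) * (ennreal 2 * ennreal (2 * r))) * (\<integral>\<^sup>+t. G t ^ 2 \<partial>lborel)"
    by (simp add: mult_ac)
  also have "ennreal (1 / (4 * r)) * (ennreal 2 * ennreal (2 * r)) = 1"
    using \<open>0 < r\<close> by (simp add: ennreal_mult[symmetric] del: ennreal_numeral)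
  finally show ?thesis by simp
qed

lemma segment_length_area:
  fixes c v :: "'a::real_normed_vector"
  assumes [measurable]: "\<rho>0 \<in> borel_measurable borel"
    and "0 < r" "- r \<le> t1" "t1 < t2" "t2 \<le> r" "norm v = sqrt 2"
    and eq: "\<And>t. t \<in> {t1..t2} \<Longrightarrow> \<rho> (c + t *\<^sub>R v) = \<rho>0 (c + t *\<^sub>R v)"
    and one: "1 \<le> path_integral \<rho> (linepath (c + t1 *\<^sub>R v) (c + t2 *\<^sub>R v))"
  shows "ennreal (1 / (4 * r)) \<le> (\<integral>\<^sup>+t. \<rho>0 (c + t *\<^sub>R v) ^ 2 \<partial>lborel)"
proof (rule length_area_step[OF _ \<open>0 < r\<close> \<open>- r \<le> t1\<close> \<open>t2 \<le> r\<close>])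
  have "continuous_on UNIV (\<lambda>t. c + t *\<^sub>R v)" by (intro continuous_intros)
  then have [measurable]: "(\<lambda>t. c + t *\<^sub>R v) \<in> borel_measurable borel"
    by (rule borel_measurable_continuous_onI)
  show m: "(\<lambda>t. \<rho>0 (c + t *\<^sub>R v)) \<in> borel_measurable borel" by measurable
  have eq': "(\<lambda>t. \<rho> (c + t *\<^sub>R v) * indicator {t1..t2} t) = (\<lambda>t. \<rho>0 (c + t *\<^sub>R v) * indicator {t1..t2} t)"
    using eq by (auto simp: fun_eq_iff indicator_def)
  have "v \<noteq> 0" using \<open>norm v = sqrt 2\<close> by auto
  moreover have "(\<lambda>t. \<rho> (c + t *\<^sub>R v) * indicator {t1..t2} t) \<in> borel_measurable borel"
    unfolding eq' by measurable
  ultimately have "path_integral \<rho> (linepath (c + t1 *\<^sub>R v) (c + t2 *\<^sub>R v)) =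
      ennreal (norm v) * (\<integral>\<^sup>+t. \<rho> (c + t *\<^sub>R v) * indicator {t1..t2} t \<partial>lborel)"
    using \<open>t1 < t2\<close> by (intro path_integral_segment)
  then show "1 \<le> ennreal (sqrt 2) * (\<integral>\<^sup>+t. \<rho>0 (c + t *\<^sub>R v) * indicator {t1..t2} t \<partial>lborel)"
    using one unfolding eq' \<open>norm v = sqrt 2\<close> by simp
qed

lemma nn_integral_infinite_if_ge_inverse:
  fixes J :: "real \<Rightarrow> ennreal"
  assumes "0 < \<delta>" and J: "\<And>r. 0 < r \<Longrightarrow> r < \<delta> \<Longrightarrow> ennreal (1 / (4 * r)) \<le> J r"
  shows "(\<integral>\<^sup>+r. J r \<partial>lborel) = \<infinity>"
proof (rule ccontr)
  assume "(\<integral>\<^sup>+r. J r \<partial>lborel) \<noteq> \<infinity>"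
  then obtain B where B: "0 \<le> B" "(\<integral>\<^sup>+r. J r \<partial>lborel) = ennreal B"
    by (cases "\<integral>\<^sup>+r. J r \<partial>lborel") auto
  define b where "b = \<delta> / 2"
  \<comment> \<open>With this \<open>a\<close>, the integral of \<open>1 / (4 * r)\<close> over \<open>{a..b}\<close> is \<open>B + 1\<close>.\<close>
  define a where "a = b * exp (- (4 * (B + 1)))"
  have b: "0 < b" "b < \<delta>" using \<open>0 < \<delta>\<close> by (auto simp: b_def)
  have a: "0 < a" "a \<le> b" using b B(1) by (auto simp: a_def mult_le_cancel_left1)
  have "(\<integral>\<^sup>+r. ennreal (1 / (4 * r)) * indicator {a..b} r \<partial>lborel) = ennreal (ln b / 4 - ln a / 4)"
  proof (rule nn_integral_FTC_Icc)
    fix x assume "x \<in> {a..b}"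
    then have "0 < x" using a by simp
    then show "((\<lambda>x. ln x / 4) has_real_derivative 1 / (4 * x)) (at x)"
      by (auto intro!: derivative_eq_intros)
    show "0 \<le> 1 / (4 * x)" using \<open>0 < x\<close> by simp
  qed (use a in auto)
  moreover have "(\<integral>\<^sup>+r. ennreal (1 / (4 * r)) * indicator {a..b} r \<partial>lborel) \<le> (\<integral>\<^sup>+r. J r \<partial>lborel)"
    using J a b by (intro nn_integral_mono) (auto simp: indicator_def)
  ultimately have "ln b / 4 - ln a / 4 \<le> B" using B by (simp add: ennreal_le_iff)
  moreover have "ln a = ln b - 4 * (B + 1)"
    using b by (simp add: a_def ln_mult)
  ultimately show False by (simp add: diff_divide_distrib add_divide_distrib)
qed

text \<open>
  The length-area estimate. If \<open>\<rho>\<close> is admissible, then for each \<open>r < \<delta>\<close> one of the two legs carries a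
  segment on which \<open>\<rho>\<close> has integral at least one. As the leg has length comparable to \<open>r\<close>, the integral
  of \<open>\<rho>\<^sup>2\<close> along it is at least \<open>1 / (4 * r)\<close>. Integrating over \<open>r\<close>, which sweeps out the disk at most
  twice (once by each family of parallel legs), bounds the area integral of \<open>\<rho>\<^sup>2\<close> from below by the
  divergent integral of \<open>1 / r\<close> near zero. The estimate is passed on from the segment to the whole
  leg before integrating, because the segments may depend on \<open>r\<close> in a non-measurable way.
\<close>

lemma Modulus_corner_segments_infinite:
  assumes z: "norm z = 1" and "0 < \<delta>" and \<Gamma>: "\<Gamma> \<subseteq> paths_in (ball 0 1)"
    and legs: "\<And>r. 0 < r \<Longrightarrow> r < \<delta> \<Longrightarrow> \<exists>t1 t2. t1 < t2 \<and> t2 \<le> r \<and>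
      (linepath (corner_chart z (r, t1)) (corner_chart z (r, t2)) \<in> \<Gamma> \<or>
       linepath (corner_chart z (t1, r)) (corner_chart z (t2, r)) \<in> \<Gamma>)"
  shows "Modulus (ball 0 1) \<Gamma> = \<infinity>"
proof -
  have "(\<integral>\<^sup>+w. \<rho> w ^ 2 \<partial>hausdorff2_measure (ball 0 1)) = \<infinity>" if "admissible (ball 0 1) \<Gamma> \<rho>" for \<rho>
  proof (rule ccontr)
    let ?M = "lborel \<Otimes>\<^sub>M lborel :: (real \<times> real) measure"
    define I where "I = (\<integral>\<^sup>+w. \<rho> w ^ 2 \<partial>hausdorff2_measure (ball 0 1))"
    assume "(\<integral>\<^sup>+w. \<rho> w ^ 2 \<partial>hausdorff2_measure (ball 0 1)) \<noteq> \<infinity>"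
    then have "I < top" by (simp add: I_def less_top)
    have \<rho>: "\<rho> \<in> borel_measurable (restrict_space borel (ball 0 1))"
      and adm: "\<And>\<gamma>. \<gamma> \<in> \<Gamma> \<Longrightarrow> rectifiable \<gamma> \<Longrightarrow> 1 \<le> path_integral \<rho> \<gamma>"
      using that by (auto simp: admissible_def)
    \<comment> \<open>An admissible function is only measurable on the disk; \<open>\<rho>0\<close> extends it by zero.\<close>
    define \<rho>0 where "\<rho>0 w = \<rho> w * indicator (ball 0 1) w" for w
    have \<rho>0[measurable]: "\<rho>0 \<in> borel_measurable borel"
      using \<rho> unfolding \<rho>0_def[abs_def] by (simp add: borel_measurable_restrict_space_iff_ennreal)
    have "continuous_on UNIV (corner_chart z)"
      unfolding corner_chart_def[abs_def] Complex_eq by (intro continuous_intros)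
    then have [measurable]: "corner_chart z \<in> borel_measurable ?M"
      unfolding lborel_prod by (simp add: borel_measurable_continuous_onI)
    define g where "g p = \<rho>0 (corner_chart z p)" for p
    have g[measurable]: "g \<in> borel_measurable ?M" unfolding g_def[abs_def] by measurable
    define J1 where "J1 r = (\<integral>\<^sup>+t. g (r, t) ^ 2 \<partial>lborel)" for r
    define J2 where "J2 r = (\<integral>\<^sup>+t. g (t, r) ^ 2 \<partial>lborel)" for r
    have J[measurable]: "J1 \<in> borel_measurable lborel" "J2 \<in> borel_measurable lborel"
      unfolding J1_def[abs_def] J2_def[abs_def] by measurable
    have leg: "ennreal (1 / (4 * r)) \<le> (\<integral>\<^sup>+t. \<rho>0 (c + t *\<^sub>R v) ^ 2 \<partial>lborel)"
      if "0 < r" "t1 < t2" "t2 \<le> r" "norm v = sqrt 2"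
        and mem: "linepath (c + t1 *\<^sub>R v) (c + t2 *\<^sub>R v) \<in> \<Gamma>"
        and low: "\<And>t. t \<le> r \<Longrightarrow> c + t *\<^sub>R v \<in> ball 0 1 \<Longrightarrow> - r \<le> t"
      for r t1 t2 c v
    proof -
      have "path_image (linepath (c + t1 *\<^sub>R v) (c + t2 *\<^sub>R v)) \<subseteq> ball 0 1"
        using subsetD[OF \<Gamma> mem] unfolding paths_in_def by simp
      then have seg: "closed_segment (c + t1 *\<^sub>R v) (c + t2 *\<^sub>R v) \<subseteq> ball 0 1" by simp
      have inball: "c + t *\<^sub>R v \<in> ball 0 1" if t: "t \<in> {t1..t2}" for t
      proof -
        define u where "u = (t - t1) / (t2 - t1)"
        have u: "0 \<le> u" "u \<le> 1" "u * (t2 - t1) = t - t1"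
          using t \<open>t1 < t2\<close> by (auto simp: u_def)
        then have tu: "t = (1 - u) * t1 + u * t2" by (simp add: algebra_simps)
        have "c + t *\<^sub>R v = (1 - u) *\<^sub>R (c + t1 *\<^sub>R v) + u *\<^sub>R (c + t2 *\<^sub>R v)"
          unfolding tu by (simp add: algebra_simps)
        then have "c + t *\<^sub>R v \<in> closed_segment (c + t1 *\<^sub>R v) (c + t2 *\<^sub>R v)"
          unfolding in_segment using u by blast
        then show ?thesis using seg by blast
      qed
      show ?thesis
      proof (rule segment_length_area[of _ r t1 t2])
        show "- r \<le> t1" using low[of t1] inball[of t1] that(2,3) by simp
        show "\<rho> (c + t *\<^sub>R v) = \<rho>0 (c + t *\<^sub>R v)" if "t \<in> {t1..t2}" for t
          using inball[OF that] by (simp add: \<rho>0_def)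
        show "1 \<le> path_integral \<rho> (linepath (c + t1 *\<^sub>R v) (c + t2 *\<^sub>R v))"
          by (rule adm[OF mem rectifiable_linepath])
      qed (use that \<rho>0 in auto)
    qed
    have sum: "ennreal (1 / (4 * r)) \<le> J1 r + J2 r" if r: "0 < r" "r < \<delta>" for r
    proof -
      have n: "norm (z * Complex (-1) (-1)) = sqrt 2" "norm (z * Complex (-1) 1) = sqrt 2"
        unfolding norm_mult z by (simp_all add: cmod_def)
      obtain t1 t2 where t: "t1 < t2" "t2 \<le> r"
        and "linepath (corner_chart z (r, t1)) (corner_chart z (r, t2)) \<in> \<Gamma> \<or>
             linepath (corner_chart z (t1, r)) (corner_chart z (t2, r)) \<in> \<Gamma>"
        using legs[OF r] by blast
      then consider "linepath (corner_chart z (r, t1)) (corner_chart z (r, t2)) \<in> \<Gamma>"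
        | "linepath (corner_chart z (t1, r)) (corner_chart z (t2, r)) \<in> \<Gamma>" by blast
      then show ?thesis
      proof cases
        case 1
        have "ennreal (1 / (4 * r)) \<le> J1 r"
          unfolding J1_def g_def corner_chart_legs(1)
        proof (rule leg[OF r(1) t n(1) 1[unfolded corner_chart_legs(1)]])
          fix t assume "t \<le> r" "z * Complex (1 - r) r + t *\<^sub>R (z * Complex (-1) (-1)) \<in> ball 0 1"
          then show "- r \<le> t"
            unfolding corner_chart_legs(1)[symmetric] corner_chart_in_ball_iff[OF z]
            by (intro leg_coordinate_bound) auto
        qed
        then show ?thesis by (simp add: add_increasing2)
      next
        case 2
        have "ennreal (1 / (4 * r)) \<le> J2 r"
          unfolding J2_def g_def corner_chart_legs(2)
        proof (rule leg[OF r(1) t n(2) 2[unfolded corner_chart_legs(2)]])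
          fix t assume "t \<le> r" "z * Complex (1 - r) (- r) + t *\<^sub>R (z * Complex (-1) 1) \<in> ball 0 1"
          then show "- r \<le> t"
            unfolding corner_chart_legs(2)[symmetric] corner_chart_in_ball_iff[OF z]
            by (intro leg_coordinate_bound) auto
        qed
        then show ?thesis by (simp add: add_increasing)
      qed
    qed
    have total: "(\<integral>\<^sup>+r. J1 r + J2 r \<partial>lborel) \<le> 2 * (ennreal (16 / pi) * I)"
    proof -
      have "(\<integral>\<^sup>+r. J1 r + J2 r \<partial>lborel) = (\<integral>\<^sup>+r. J1 r \<partial>lborel) + (\<integral>\<^sup>+r. J2 r \<partial>lborel)"
        by (rule nn_integral_add) measurable
      also have "(\<integral>\<^sup>+r. J1 r \<partial>lborel) = (\<integral>\<^sup>+p. g p ^ 2 \<partial>?M)"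
        unfolding J1_def by (rule lborel.nn_integral_fst) measurable
      also have "(\<integral>\<^sup>+r. J2 r \<partial>lborel) = (\<integral>\<^sup>+p. g p ^ 2 \<partial>?M)"
        unfolding J2_def by (rule lborel_pair.nn_integral_snd) measurable
      also have "(\<integral>\<^sup>+p. g p ^ 2 \<partial>?M) =
          (\<integral>\<^sup>+p. \<rho> (corner_chart z p) ^ 2 * indicator (ball 0 1) (corner_chart z p) \<partial>?M)"
        by (intro nn_integral_cong) (auto simp: g_def \<rho>0_def indicator_def)
      also have "\<dots> \<le> ennreal (16 / pi) * I"
        unfolding I_def using \<rho>
        by (intro nn_integral_le_hausdorff2_measure corner_chart_coordinate_le[OF z]) auto
      finally show ?thesis by (simp add: mult_2 add_mono)
    qed
    have "(\<integral>\<^sup>+r. J1 r + J2 r \<partial>lborel) = \<infinity>"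
      using \<open>0 < \<delta>\<close> sum by (rule nn_integral_infinite_if_ge_inverse)
    then show False
      using total \<open>I < top\<close> by (auto simp: top_unique ennreal_mult_eq_top_iff)
  qed
  then show ?thesis
    unfolding Modulus_def by (auto intro!: antisym INF_greatest)
qed

section \<open>Extending homeomorphisms of the ball by means of short crosscuts\<close>

text \<open>
  The segment from \<open>0\<close> to \<open>x\<close> is connected and joins the two open sets, so it cannot avoid \<open>A\<close>.
\<close>

lemma radial_segment_meets_separator:
  fixes W1 W2 A :: "'a::real_normed_vector set"
  assumes "open W1" "open W2" "W1 \<inter> W2 = {}" and cover: "ball 0 1 \<subseteq> A \<union> W1 \<union> W2"
    and "0 \<in> W2" "x \<in> W1" "norm x < 1"
  shows "\<exists>t\<in>{0..1}. t *\<^sub>R x \<in> A"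
proof (rule ccontr)
  assume no: "\<not> ?thesis"
  have seg: "closed_segment 0 x = (\<lambda>t. t *\<^sub>R x) ` {0..1}"
    by (auto simp: closed_segment_def)
  have "norm (t *\<^sub>R x) < 1" if "t \<in> {0..1}" for t
    using that \<open>norm x < 1\<close> mult_right_mono[of t 1 "norm x"] by simp
  then have "t *\<^sub>R x \<in> W1 \<union> W2" if "t \<in> {0..1}" for t
    using that cover no by (meson UnE UnI1 UnI2 mem_ball_0 subsetD)
  then have "closed_segment 0 x \<subseteq> W1 \<union> W2"
    unfolding seg by blast
  moreover have "0 \<in> closed_segment 0 x" "x \<in> closed_segment 0 x" by auto
  ultimately show False
    using connectedD[OF connected_segment(1)[of 0 x] \<open>open W1\<close> \<open>open W2\<close>] assms by blast
qed

text \<open>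
  \<open>C\<close> separates the ball into \<open>V1\<close>, which contains all points near \<open>z\<close>, and the rest \<open>V2\<close>; everything but
  \<open>V2\<close> is within \<open>\<delta>\<close> of \<open>z\<close>, and \<open>s\<close> bounds the diameter of \<open>f ` C\<close>.
\<close>

definition has_short_crosscut ::
    "('a::real_normed_vector \<Rightarrow> 'b::metric_space) \<Rightarrow> 'a \<Rightarrow> real \<Rightarrow> real \<Rightarrow> bool" where
  "has_short_crosscut f z s \<delta> \<longleftrightarrow>
     (\<exists>C V1 V2 r. open V1 \<and> open V2 \<and> V1 \<inter> V2 = {} \<and> C \<union> V1 \<union> V2 = ball 0 1 \<and> 0 < r \<and>
        ball 0 1 \<inter> ball z r \<subseteq> V1 \<and> C \<union> V1 \<subseteq> ball z \<delta> \<and> (\<forall>a\<in>C. \<forall>b\<in>C. dist (f a) (f b) \<le> s))"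

lemma has_short_crosscut_compose:
  assumes cut: "has_short_crosscut f z s \<delta>"
    and h: "\<And>a b. a \<in> ball 0 1 \<Longrightarrow> b \<in> ball 0 1 \<Longrightarrow> dist (f a) (f b) \<le> s \<Longrightarrow> dist (h (f a)) (h (f b)) \<le> s'"
  shows "has_short_crosscut (h \<circ> f) z s' \<delta>"
proof -
  from cut obtain C V1 V2 r where V: "open V1 \<and> open V2 \<and> V1 \<inter> V2 = {} \<and> C \<union> V1 \<union> V2 = ball 0 1 \<and> 0 < r \<and>
      ball 0 1 \<inter> ball z r \<subseteq> V1 \<and> C \<union> V1 \<subseteq> ball z \<delta>" and C: "\<forall>a\<in>C. \<forall>b\<in>C. dist (f a) (f b) \<le> s"
    unfolding has_short_crosscut_def by (elim exE conjE) (rule that; blast)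
  have "C \<subseteq> ball 0 1" using V by blast
  then have "\<forall>a\<in>C. \<forall>b\<in>C. dist ((h \<circ> f) a) ((h \<circ> f) b) \<le> s'"
    using C h by (simp add: subset_iff)
  with V have "open V1 \<and> open V2 \<and> V1 \<inter> V2 = {} \<and> C \<union> V1 \<union> V2 = ball 0 1 \<and> 0 < r \<and>
      ball 0 1 \<inter> ball z r \<subseteq> V1 \<and> C \<union> V1 \<subseteq> ball z \<delta> \<and> (\<forall>a\<in>C. \<forall>b\<in>C. dist ((h \<circ> f) a) ((h \<circ> f) b) \<le> s')"
    by simp
  then show ?thesis unfolding has_short_crosscut_def by (intro exI)
qed

text \<open>
  Why a short crosscut cuts off a small piece. A crosscut close to \<open>z\<close> has an image \<open>f ` C\<close> close to the
  unit sphere, because \<open>g\<close> maps compact subsets of the ball to compact sets, which stay away from \<open>z\<close>.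
  The image separates the image \<open>W V1\<close> of the cut off piece from the origin, so the radius through any
  point of \<open>W V1\<close> meets \<open>f ` C\<close>. The meeting point and the given point both have norm at least \<open>1 - s\<close>
  and lie on one radius, so they are within \<open>s\<close> of each other. Hence the whole piece is within \<open>s\<close> of a
  set of diameter at most \<open>s\<close>.
\<close>

lemma small_oscillation_near_boundary:
  fixes f g :: "'a::euclidean_space \<Rightarrow> 'a"
  assumes hom: "homeomorphism (ball 0 1) (ball 0 1) f g" and z: "z \<in> sphere 0 1"
    and crosscut: "\<And>s \<delta>. 0 < s \<Longrightarrow> 0 < \<delta> \<Longrightarrow> has_short_crosscut f z s \<delta>"
    and "0 < e"
  shows "\<exists>r>0. \<forall>x\<in>ball 0 1 \<inter> ball z r. \<forall>y\<in>ball 0 1 \<inter> ball z r. dist (f x) (f y) \<le> e"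
proof -
  define s where "s = min (e / 3) (1 / 2)"
  have s: "0 < s" "3 * s \<le> e" "s \<le> 1 / 2" using \<open>0 < e\<close> by (auto simp: s_def)
  have f: "\<And>x. x \<in> ball 0 1 \<Longrightarrow> f x \<in> ball 0 1" "\<And>x. x \<in> ball 0 1 \<Longrightarrow> g (f x) = x"
    and g: "\<And>y. y \<in> ball 0 1 \<Longrightarrow> g y \<in> ball 0 1" "\<And>y. y \<in> ball 0 1 \<Longrightarrow> f (g y) = y"
    "continuous_on (ball 0 1) g"
    using hom by (force simp: homeomorphism_def)+
  have sub: "cball 0 (1 - s) \<subseteq> ball (0::'a) 1" using s by auto
  have "compact (g ` cball 0 (1 - s))"
    by (intro compact_continuous_image continuous_on_subset[OF g(3) sub]) auto
  moreover have "z \<notin> g ` cball 0 (1 - s)"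
    using g(1) sub z by fastforce
  ultimately obtain \<delta> where \<delta>: "0 < \<delta>" "ball z \<delta> \<subseteq> - g ` cball 0 (1 - s)"
    by (meson ComplI compact_imp_closed open_Compl open_contains_ball)
  obtain C V1 V2 r where V: "open V1" "open V2" "V1 \<inter> V2 = {}" "C \<union> V1 \<union> V2 = ball 0 1" "0 < r"
      "ball 0 1 \<inter> ball z r \<subseteq> V1" "C \<union> V1 \<subseteq> ball z \<delta>"
    and C: "\<And>a b. a \<in> C \<Longrightarrow> b \<in> C \<Longrightarrow> dist (f a) (f b) \<le> s"
    using crosscut[OF s(1) \<delta>(1)] unfolding has_short_crosscut_def by metis
  have Cnorm: "1 - s \<le> norm (f a)" if "a \<in> C" for a
  proof (rule ccontr)
    assume "\<not> ?thesis"
    moreover have "g (f a) = a" using that V(4) f(2)[of a] by blast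
    ultimately have "a \<in> g ` cball 0 (1 - s)"
      by (intro image_eqI[of _ _ "f a"]) auto
    then show False using that V(7) \<delta>(2) by blast
  qed
  \<comment> \<open>\<open>W U\<close> is \<open>f ` U\<close> for \<open>U\<close> in the ball, written as a preimage so that it is visibly open.\<close>
  define W where "W U = {y \<in> ball 0 1. g y \<in> U}" for U
  have openW: "open (W U)" if "open U" for U
    using continuous_on_open_vimage[OF open_ball, of 0 1 g] g(3) that by (simp add: W_def vimage_def Int_def conj_commute)
  have "g 0 \<in> V2"
  proof -
    have "g 0 \<in> g ` cball 0 (1 - s)" using s by auto
    moreover have "g 0 \<in> C \<union> V1 \<union> V2" using V(4) g(1)[of 0] by simp
    ultimately show ?thesis using V(7) \<delta>(2) by blast
  qed
  then have 0: "0 \<in> W V2" by (simp add: W_def)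
  have cover: "ball 0 1 \<subseteq> f ` C \<union> W V1 \<union> W V2"
  proof
    fix y :: 'a assume y: "y \<in> ball 0 1"
    then have "g y \<in> C \<union> V1 \<union> V2" using g(1) V(4) by simp
    moreover have "y \<in> f ` C" if "g y \<in> C" using that g(2)[OF y] by (metis image_eqI)
    ultimately show "y \<in> f ` C \<union> W V1 \<union> W V2" using y by (auto simp: W_def)
  qed
  have near: "\<exists>a\<in>C. dist (f x) (f a) \<le> s" if "x \<in> V1" for x
  proof -
    have x: "x \<in> ball 0 1" using that V(4) by blast
    then have fx: "norm (f x) < 1" "f x \<in> W V1" using f that by (auto simp: W_def)
    have "W V1 \<inter> W V2 = {}" using V(3) by (auto simp: W_def)
    then obtain t where t: "t \<in> {0..1}" "t *\<^sub>R f x \<in> f ` C"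
      using radial_segment_meets_separator[OF openW[OF V(1)] openW[OF V(2)] _ cover 0 fx(2,1)] by blast
    then obtain a where a: "a \<in> C" "f a = t *\<^sub>R f x" by auto
    have "f x - f a = (1 - t) *\<^sub>R f x" using a by (simp add: algebra_simps)
    then have "dist (f x) (f a) = (1 - t) * norm (f x)" using t by (simp add: dist_norm)
    also have "\<dots> = norm (f x) - norm (f a)" using a t by (simp add: algebra_simps)
    also have "\<dots> \<le> s" using Cnorm[OF a(1)] fx(1) by simp
    finally show ?thesis using a(1) by blast
  qed
  have "dist (f x) (f y) \<le> e" if xy: "x \<in> V1" "y \<in> V1" for x y
  proof -
    obtain a b where ab: "a \<in> C" "dist (f x) (f a) \<le> s" "b \<in> C" "dist (f y) (f b) \<le> s"
      using near xy by meson
    have "dist (f x) (f y) \<le> dist (f x) (f a) + dist (f a) (f b) + dist (f b) (f y)"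
      using dist_triangle[of "f x" "f y" "f a"] dist_triangle[of "f a" "f y" "f b"] by linarith
    also have "\<dots> \<le> 3 * s" using ab C[of a b] by (simp add: dist_commute)
    finally show ?thesis using s(2) by simp
  qed
  then show ?thesis using V(5,6) by blast
qed

text \<open>
  A Lebesgue number of the cover by balls of small oscillation is the required modulus of continuity.
\<close>

lemma uniformly_continuous_on_if_small_oscillation:
  fixes f :: "'a::metric_space \<Rightarrow> 'b::metric_space"
  assumes "compact K" "S \<subseteq> K"
    and osc: "\<And>z e. z \<in> K \<Longrightarrow> 0 < e \<Longrightarrow> \<exists>r>0. \<forall>x\<in>S \<inter> ball z r. \<forall>y\<in>S \<inter> ball z r. dist (f x) (f y) \<le> e"
  shows "uniformly_continuous_on S f"
  unfolding uniformly_continuous_on_def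
proof (intro allI impI)
  fix e :: real assume "0 < e"
  then obtain r where r: "\<And>z. z \<in> K \<Longrightarrow> 0 < r z"
    "\<And>z x y. z \<in> K \<Longrightarrow> x \<in> S \<inter> ball z (r z) \<Longrightarrow> y \<in> S \<inter> ball z (r z) \<Longrightarrow> dist (f x) (f y) \<le> e / 2"
    using osc[of _ "e / 2"] by (metis half_gt_zero)
  obtain d where d: "0 < d" "\<And>x. x \<in> K \<Longrightarrow> \<exists>G\<in>(\<lambda>z. ball z (r z)) ` K. ball x d \<subseteq> G"
  proof (rule Heine_Borel_lemma[OF \<open>compact K\<close>, of "(\<lambda>z. ball z (r z)) ` K"])
    show "K \<subseteq> \<Union> ((\<lambda>z. ball z (r z)) ` K)" using r(1) by force
  qed auto
  have "dist (f x') (f x) < e" if "x \<in> S" "x' \<in> S" "dist x' x < d" for x x'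
  proof -
    have "x \<in> K" using that \<open>S \<subseteq> K\<close> by blast
    then obtain z where z: "z \<in> K" "ball x d \<subseteq> ball z (r z)"
      using d(2)[of x] by blast
    have "x \<in> ball x d" "x' \<in> ball x d" using d(1) that by (auto simp: dist_commute)
    then have "dist (f x') (f x) \<le> e / 2" using r(2)[OF z(1)] z(2) that by blast
    then show ?thesis using \<open>0 < e\<close> by simp
  qed
  then show "\<exists>d>0. \<forall>x\<in>S. \<forall>x'\<in>S. dist x' x < d \<longrightarrow> dist (f x') (f x) < e" using d(1) by blast
qed

text \<open>
  The fibre of \<open>F\<close> over \<open>y\<close> is the intersection of the closures of the sets
  \<open>g ` (ball 0 1 \<inter> ball y (1 / (n + 1)))\<close>. The intersection of two balls is convex, so these closures are
  decreasing continua, and a decreasing intersection of continua is connected. Boundary points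
  go to boundary points, since otherwise \<open>g\<close> would return them to the interior.
\<close>

lemma closure_extension_monotone:
  fixes f g F :: "'a::euclidean_space \<Rightarrow> 'a"
  assumes hom: "homeomorphism (ball 0 1) (ball 0 1) f g"
    and F: "continuous_on (cball 0 1) F" "\<And>x. x \<in> ball 0 1 \<Longrightarrow> F x = f x"
  shows "F ` cball 0 1 = cball 0 1" "F ` sphere 0 1 = sphere 0 1"
    and "connected {x \<in> cball 0 1. F x = y}"
proof -
  have f: "\<And>x. x \<in> ball 0 1 \<Longrightarrow> f x \<in> ball 0 1" "\<And>x. x \<in> ball 0 1 \<Longrightarrow> g (f x) = x"
    and g: "\<And>y. y \<in> ball 0 1 \<Longrightarrow> g y \<in> ball 0 1" "\<And>y. y \<in> ball 0 1 \<Longrightarrow> f (g y) = y"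
    "continuous_on (ball 0 1) g" "f ` ball 0 1 = ball 0 1"
    using hom by (force simp: homeomorphism_def)+
  have Fball: "F ` ball 0 1 = ball 0 1" using F(2) g(4) by (metis image_cong)
  show img: "F ` cball 0 1 = cball 0 1"
  proof
    have "F ` closure (ball 0 1) \<subseteq> closure (ball 0 1)"
      by (rule image_closure_subset) (use F(1) Fball closure_subset[of "ball (0::'a) 1"] in auto)
    then show "F ` cball 0 1 \<subseteq> cball 0 1" by simp
    have "closure (ball 0 1) \<subseteq> F ` cball 0 1"
    proof (rule closure_minimal)
      show "ball 0 1 \<subseteq> F ` cball 0 1" using Fball by force
      show "closed (F ` cball 0 1)"
        by (intro compact_imp_closed compact_continuous_image F(1)) auto
    qed
    then show "cball 0 1 \<subseteq> F ` cball 0 1" by simp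
  qed
  have seq: "\<exists>u. (\<forall>n::nat. u n \<in> ball 0 1) \<and> u \<longlonglongrightarrow> x \<and> (\<lambda>n. f (u n)) \<longlonglongrightarrow> F x" if "x \<in> cball 0 1" for x
  proof -
    have "x \<in> closure (ball 0 1)" using that by simp
    then obtain u where u: "\<And>n. u n \<in> ball 0 1" "u \<longlonglongrightarrow> x"
      unfolding closure_sequential by blast
    have "(\<lambda>n. F (u n)) \<longlonglongrightarrow> F x"
      using F(1) that u unfolding continuous_on_sequentially by (auto simp: comp_def less_imp_le)
    then show ?thesis using u F(2) by (intro exI[of _ u]) auto
  qed
  have "F x \<in> sphere 0 1" if x: "x \<in> sphere 0 1" for x
  proof (rule ccontr)
    assume "F x \<notin> sphere 0 1"
    moreover have "F x \<in> cball 0 1" using imageI[of x "cball 0 1" F] img x by auto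
    ultimately have Fx: "F x \<in> ball 0 1" by auto
    obtain u where u: "\<And>n. u n \<in> ball 0 1" "u \<longlonglongrightarrow> x" "(\<lambda>n. f (u n)) \<longlonglongrightarrow> F x"
      using seq[of x] x by auto
    have "(\<lambda>n. g (f (u n))) \<longlonglongrightarrow> g (F x)"
      using g(3) Fx f(1) u unfolding continuous_on_sequentially by (auto simp: comp_def)
    then have "x = g (F x)" using u f(2) by (simp add: LIMSEQ_unique)
    then show False using g(1)[OF Fx] x by simp
  qed
  moreover have "y \<in> F ` sphere 0 1" if y: "y \<in> sphere 0 1" for y
  proof -
    obtain x where x: "x \<in> cball 0 1" "y = F x" using img y by (metis imageE mem_cball mem_sphere order_refl)
    have "x \<notin> ball 0 1" using Fball y x by force
    then show ?thesis using x by auto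
  qed
  ultimately show "F ` sphere 0 1 = sphere 0 1" by blast
  define S where "S n = closure (g ` (ball 0 1 \<inter> ball y (1 / real (Suc n))))" for n
  have conn: "connected (\<Inter> (range S))"
  proof (rule connected_nest)
    fix n
    have sub: "g ` (ball 0 1 \<inter> ball y (1 / real (Suc n))) \<subseteq> ball 0 1" using g(1) by blast
    then show "compact (S n)"
      unfolding S_def by (intro compact_closure[THEN iffD2] bounded_subset[OF bounded_ball])
    show "connected (S n)"
      unfolding S_def
      by (intro connected_imp_connected_closure connected_continuous_image
        continuous_on_subset[OF g(3)] convex_connected convex_Int convex_ball) auto
  next
    fix m n :: nat assume "m \<le> n"
    then have "1 / real (Suc n) \<le> 1 / real (Suc m)" by (simp add: frac_le)
    then show "S n \<subseteq> S m"
      unfolding S_def by (intro closure_mono image_mono Int_mono subset_ball) auto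
  qed
  have "\<Inter> (range S) = {x \<in> cball 0 1. F x = y}"
  proof (intro equalityI subsetI)
    fix x assume x: "x \<in> \<Inter> (range S)"
    have *: "x \<in> cball 0 1 \<and> dist y (F x) \<le> 1 / real (Suc n)" for n
    proof -
      let ?T = "{x \<in> cball 0 1. F x \<in> cball y (1 / real (Suc n))}"
      have "closed ?T"
        using continuous_closed_preimage[OF F(1) closed_cball closed_cball] by (simp only: vimage_def Int_def mem_Collect_eq)
      moreover have "g ` (ball 0 1 \<inter> ball y (1 / real (Suc n))) \<subseteq> ?T"
      proof
        fix x assume "x \<in> g ` (ball 0 1 \<inter> ball y (1 / real (Suc n)))"
        then obtain w where w: "w \<in> ball 0 1" "w \<in> ball y (1 / real (Suc n))" "x = g w" by blast
        then have "F x = w" "x \<in> ball 0 1" using g F(2) by auto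
        then show "x \<in> ?T" using w by (simp add: less_imp_le)
      qed
      ultimately have "S n \<subseteq> ?T" unfolding S_def by (rule closure_minimal[rotated])
      then show ?thesis using x by auto
    qed
    have "dist y (F x) \<le> 0"
    proof (rule field_le_epsilon)
      fix e :: real assume "0 < e"
      then obtain n where "1 / real (Suc n) < e" by (metis reals_Archimedean inverse_eq_divide)
      then show "dist y (F x) \<le> 0 + e" using *[of n] by simp
    qed
    then show "x \<in> {x \<in> cball 0 1. F x = y}" using * by simp
  next
    fix x assume "x \<in> {x \<in> cball 0 1. F x = y}"
    then obtain u where u: "\<And>n. u n \<in> ball 0 1" "u \<longlonglongrightarrow> x" "(\<lambda>n. f (u n)) \<longlonglongrightarrow> y"
      using seq[of x] by auto
    have "x \<in> S n" for n
      unfolding S_def closure_approachable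
    proof (intro allI impI)
      fix e :: real assume "0 < e"
      have "\<forall>\<^sub>F k in sequentially. dist (f (u k)) y < 1 / real (Suc n)"
        by (rule tendstoD[OF u(3)]) simp
      moreover have "\<forall>\<^sub>F k in sequentially. dist (u k) x < e"
        using \<open>0 < e\<close> by (rule tendstoD[OF u(2)])
      ultimately have "\<forall>\<^sub>F k in sequentially. dist (f (u k)) y < 1 / real (Suc n) \<and> dist (u k) x < e"
        by (rule eventually_conj)
      then obtain k where k: "dist (f (u k)) y < 1 / real (Suc n)" "dist (u k) x < e"
        by (auto simp: eventually_sequentially)
      then have "u k \<in> g ` (ball 0 1 \<inter> ball y (1 / real (Suc n)))"
        using f[OF u(1)] by (intro image_eqI[of _ _ "f (u k)"]) (auto simp: dist_commute)
      then show "\<exists>v\<in>g ` (ball 0 1 \<inter> ball y (1 / real (Suc n))). dist v x < e" using k by blast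
    qed
    then show "x \<in> \<Inter> (range S)" by blast
  qed
  with conn show "connected {x \<in> cball 0 1. F x = y}" by simp
qed

lemma ball_homeomorphism_extends:
  fixes f g :: "'a::euclidean_space \<Rightarrow> 'a"
  assumes hom: "homeomorphism (ball 0 1) (ball 0 1) f g"
    and crosscut: "\<And>z s \<delta>. z \<in> sphere 0 1 \<Longrightarrow> 0 < s \<Longrightarrow> 0 < \<delta> \<Longrightarrow> has_short_crosscut f z s \<delta>"
  obtains F where "continuous_on (cball 0 1) F" "\<And>x. x \<in> ball 0 1 \<Longrightarrow> F x = f x"
    "F ` cball 0 1 = cball 0 1" "F ` sphere 0 1 = sphere 0 1"
    "\<And>y. connected {x \<in> cball 0 1. F x = y}"
proof -
  have "uniformly_continuous_on (ball 0 1) f"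
  proof (rule uniformly_continuous_on_if_small_oscillation[of "cball 0 1"])
    fix z :: 'a and e :: real
    assume "z \<in> cball 0 1" "0 < e"
    show "\<exists>r>0. \<forall>x\<in>ball 0 1 \<inter> ball z r. \<forall>y\<in>ball 0 1 \<inter> ball z r. dist (f x) (f y) \<le> e"
    proof (cases "z \<in> sphere 0 1")
      case True
      show ?thesis
        by (rule small_oscillation_near_boundary[OF hom True _ \<open>0 < e\<close>]) (rule crosscut[OF True])
    next
      case False
      then have "z \<in> ball 0 1" using \<open>z \<in> cball 0 1\<close> by auto
      then obtain r where r: "0 < r" "\<And>x. x \<in> ball 0 1 \<Longrightarrow> dist x z < r \<Longrightarrow> dist (f x) (f z) < e / 2"
        using homeomorphism_cont1[OF hom] \<open>0 < e\<close> unfolding continuous_on_iff by (meson half_gt_zero)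
      have "dist (f x) (f y) \<le> e" if "x \<in> ball 0 1 \<inter> ball z r" "y \<in> ball 0 1 \<inter> ball z r" for x y
        using r(2)[of x] r(2)[of y] that dist_triangle_half_l[of "f x" "f z" e "f y"]
        by (auto simp: dist_commute less_imp_le)
      then show ?thesis using r(1) by blast
    qed
  qed auto
  then obtain F where F: "uniformly_continuous_on (closure (ball 0 1)) F" "\<And>x. x \<in> ball 0 1 \<Longrightarrow> f x = F x"
    by (rule uniformly_continuous_on_extension_on_closure) (rule that)
  have cont: "continuous_on (cball 0 1) F"
    using uniformly_continuous_imp_continuous[OF F(1)] by simp
  show thesis
    by (rule that[OF cont F(2)[symmetric] closure_extension_monotone[OF hom cont F(2)[symmetric]]])
qed

section \<open>The boundary circle of a Jordan domain\<close>

text \<open>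
  A circle is not homeomorphic to a proper subset of a circle: omitting a point would embed it into a
  punctured circle, that is, into a line.
\<close>

lemma sphere_subset_homeomorphic_sphere_eq:
  fixes J :: "complex set"
  assumes "sphere 0 1 \<subseteq> J" "J homeomorphic (sphere 0 1 :: complex set)"
  shows "J = sphere 0 1"
proof (rule ccontr)
  assume "J \<noteq> sphere 0 1"
  then obtain p where p: "p \<in> J" "p \<notin> sphere 0 1" using assms(1) by blast
  obtain k k' where k: "homeomorphism J (sphere 0 1 :: complex set) k k'"
    using assms(2) unfolding homeomorphic_def by blast
  define q where "q = k p"
  have q: "q \<in> sphere 0 1" using k p(1) unfolding q_def by (force simp: homeomorphism_def)
  have ksub: "k ` sphere 0 1 \<subseteq> sphere 0 1 - {q}"
  proof
    fix w assume "w \<in> k ` sphere 0 1"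
    then obtain x where x: "x \<in> sphere 0 1" "w = k x" by blast
    have "k x \<noteq> k p"
      using k p x(1) assms(1) by (metis homeomorphism_apply1 subsetD)
    then show "w \<in> sphere 0 1 - {q}"
      using x k assms(1) by (auto simp: q_def homeomorphism_def)
  qed
  have "(sphere (0::complex) 1 - {q}) homeomorphic (UNIV :: real set)"
    by (rule homeomorphic_punctured_sphere_affine) (use q in auto)
  then obtain l l' where l: "homeomorphism (sphere 0 1 - {q}) (UNIV :: real set) l l'"
    unfolding homeomorphic_def by blast
  have "continuous_on (sphere 0 1) (l \<circ> k)"
    using k l ksub assms(1)
    by (intro continuous_on_compose) (auto simp: homeomorphism_def intro: continuous_on_subset)
  moreover have "inj_on (l \<circ> k) (sphere 0 1)"
  proof (rule comp_inj_on)
    show "inj_on k (sphere 0 1)"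
      using k assms(1) by (intro inj_on_inverseI[of _ k']) (auto simp: homeomorphism_def)
    show "inj_on l (k ` sphere 0 1)"
      using l ksub by (intro inj_on_inverseI[of _ l']) (auto simp: homeomorphism_def)
  qed
  ultimately have "DIM(complex) \<le> DIM(real)"
    by (rule no_embedding_sphere_lowdim) simp
  then show False by simp
qed

section \<open>Short crosscuts\<close>

text \<open>
  The two rays whose parts inside the disk make up the crosscut at height \<open>r\<close>.
\<close>

definition corner_legs :: "complex \<Rightarrow> real \<Rightarrow> complex set set" where
  "corner_legs z r = {(\<lambda>t. corner_chart z (r, t)) ` {..r}, (\<lambda>t. corner_chart z (t, r)) ` {..r}}"

text \<open>
  If all legs near \<open>z\<close> had long images, the family \<open>\<Gamma>\<close> of paths whose images have endpoints at distance
  at least \<open>c\<close> would contain a leg segment at every small height, and its modulus would be infinite.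
  But the modulus of the image family is at most the area of \<open>W\<close> divided by \<open>c\<^sup>2\<close>, and a quasiconformal
  map does not turn infinite modulus into finite modulus.
\<close>

lemma quasiconformal_short_legs:
  fixes \<phi> :: "complex \<Rightarrow> 'a::metric_space"
  assumes qc: "quasiconformal (ball 0 1) W \<phi>" and fin: "hausdorff2 W < \<infinity>"
    and z: "norm z = 1" and "0 < c" "0 < \<delta>"
  shows "\<exists>r>0. r < \<delta> \<and>
    (\<forall>L\<in>corner_legs z r. \<forall>a\<in>L \<inter> ball 0 1. \<forall>b\<in>L \<inter> ball 0 1. dist (\<phi> a) (\<phi> b) < c)"
proof (rule ccontr)
  assume neg: "\<not> ?thesis"
  obtain K where K: "1 \<le> K" "K_quasiconformal K (ball 0 1) W \<phi>"
    using qc by (auto simp: quasiconformal_def)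
  define \<Gamma> where "\<Gamma> = {\<gamma> \<in> paths_in (ball 0 1). c \<le> dist (\<phi> (\<gamma> 0)) (\<phi> (\<gamma> 1))}"
  have sub: "\<Gamma> \<subseteq> paths_in (ball 0 1)" by (auto simp: \<Gamma>_def)
  have \<Gamma>: "linepath a b \<in> \<Gamma>" if "a \<in> ball 0 1" "b \<in> ball 0 1" "c \<le> dist (\<phi> a) (\<phi> b)" for a b
    using that closed_segment_subset[OF that(1,2)] by (simp add: \<Gamma>_def paths_in_def linepath_0' linepath_1')
  have "Modulus (ball 0 1) \<Gamma> = \<infinity>"
  proof (rule Modulus_corner_segments_infinite[OF z \<open>0 < \<delta>\<close> sub])
    fix r assume r: "0 < r" "r < \<delta>"
    \<comment> \<open>The distance is symmetric, so the parameters of the endpoints may be put in increasing order.\<close>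
    have ordered: "\<exists>t1 t2. t1 < t2 \<and> t2 \<le> r \<and> linepath (h t1) (h t2) \<in> \<Gamma>"
      if ab: "a \<in> h ` {..r} \<inter> ball 0 1" "b \<in> h ` {..r} \<inter> ball 0 1" "c \<le> dist (\<phi> a) (\<phi> b)" for h a b
    proof -
      obtain t t' where t: "a = h t" "b = h t'" "t \<le> r" "t' \<le> r" using ab by blast
      have "t \<noteq> t'" using ab(3) t \<open>0 < c\<close> by auto
      then consider "t < t'" | "t' < t" by linarith
      then show ?thesis
      proof cases
        case 1
        have "linepath (h t) (h t') \<in> \<Gamma>" using \<Gamma>[of a b] ab t(1,2) by simp
        then show ?thesis using 1 t(4) by blast
      next
        case 2
        have "linepath (h t') (h t) \<in> \<Gamma>" using \<Gamma>[of b a] ab t(1,2) by (simp add: dist_commute)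
        then show ?thesis using 2 t(3) by blast
      qed
    qed
    obtain L a b where L: "L \<in> corner_legs z r" and ab: "a \<in> L \<inter> ball 0 1" "b \<in> L \<inter> ball 0 1" "c \<le> dist (\<phi> a) (\<phi> b)"
      using neg r unfolding not_less[symmetric] by blast
    have "L = (\<lambda>t. corner_chart z (r, t)) ` {..r} \<or> L = (\<lambda>t. corner_chart z (t, r)) ` {..r}"
      using L by (simp add: corner_legs_def)
    then show "\<exists>t1 t2. t1 < t2 \<and> t2 \<le> r \<and>
      (linepath (corner_chart z (r, t1)) (corner_chart z (r, t2)) \<in> \<Gamma> \<or>
       linepath (corner_chart z (t1, r)) (corner_chart z (t2, r)) \<in> \<Gamma>)"
    proof
      assume "L = (\<lambda>t. corner_chart z (r, t)) ` {..r}"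
      from ordered[OF ab[unfolded this]] show ?thesis by blast
    next
      assume "L = (\<lambda>t. corner_chart z (t, r)) ` {..r}"
      from ordered[OF ab[unfolded this]] show ?thesis by blast
    qed
  qed
  then have "ennreal (1 / K) * Modulus (ball 0 1) \<Gamma> = \<infinity>"
    using K(1) by (simp add: ennreal_mult_eq_top_iff)
  moreover have "ennreal (1 / K) * Modulus (ball 0 1) \<Gamma> \<le> Modulus W ((\<lambda>\<gamma>. \<phi> \<circ> \<gamma>) ` \<Gamma>)"
    using K(2) sub unfolding K_quasiconformal_def by blast
  moreover have "Modulus W ((\<lambda>\<gamma>. \<phi> \<circ> \<gamma>) ` \<Gamma>) \<le> ennreal (1 / c) ^ 2 * hausdorff2 W"
    using \<open>0 < c\<close> by (rule Modulus_le_if_endpoints_apart) (auto simp: \<Gamma>_def)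
  moreover have "ennreal (1 / c) ^ 2 * hausdorff2 W < \<infinity>"
    using fin by (simp add: ennreal_mult_less_top power_less_top_ennreal)
  ultimately show False by (simp add: top_unique)
qed

text \<open>
  The inverse of \<^const>\<open>corner_chart\<close>.
\<close>

definition corner_coords :: "complex \<Rightarrow> complex \<Rightarrow> real \<times> real" where
  "corner_coords z w = (let q = 1 - w / z in ((Re q - Im q) / 2, (Re q + Im q) / 2))"

lemma corner_chart_coords: "z \<noteq> 0 \<Longrightarrow> corner_chart z (corner_coords z w) = w"
proof -
  assume "z \<noteq> 0"
  have "Complex (fst (corner_coords z w) + snd (corner_coords z w)) (snd (corner_coords z w) - fst (corner_coords z w)) = 1 - w / z"
    by (simp add: corner_coords_def Let_def complex_eq_iff field_simps)
  then show ?thesis using \<open>z \<noteq> 0\<close> by (simp add: corner_chart_def)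
qed

lemma corner_crosscut:
  assumes z: "norm z = 1" and r: "0 < r" "r < 1"
  defines "D \<equiv> ball (0::complex) 1"
  defines "m \<equiv> \<lambda>w. max (fst (corner_coords z w)) (snd (corner_coords z w))"
  shows "open {w \<in> D. m w < r}" "open {w \<in> D. r < m w}"
    and "D \<inter> ball z r \<subseteq> {w \<in> D. m w < r}"
    and "{w \<in> D. m w \<le> r} \<subseteq> cball z (4 * r)"
    and "\<And>w. m w = r \<Longrightarrow> \<exists>L\<in>corner_legs z r. w \<in> L"
    and "\<And>L. L \<in> corner_legs z r \<Longrightarrow> corner_chart z (r, r) \<in> L \<inter> D"
proof -
  have z0: "z \<noteq> 0" using z by auto
  have chart: "corner_chart z (fst (corner_coords z w), snd (corner_coords z w)) = w" for w
    using corner_chart_coords[OF z0] by simp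
  have base: "corner_chart z (0, 0) = z" by (simp add: corner_chart_def complex_eq_iff)
  have cont: "continuous_on UNIV m"
    unfolding m_def corner_coords_def Let_def using z0 by (auto intro!: continuous_intros)
  have "{w \<in> D. m w < r} = D \<inter> {w. m w < r}" "{w \<in> D. r < m w} = D \<inter> {w. r < m w}" by auto
  moreover have "open {w. m w < r}" "open {w. r < m w}"
    using cont by (auto intro!: open_Collect_less)
  ultimately show "open {w \<in> D. m w < r}" "open {w \<in> D. r < m w}"
    by (simp_all add: D_def open_Int)
  show "D \<inter> ball z r \<subseteq> {w \<in> D. m w < r}"
  proof
    fix w assume w: "w \<in> D \<inter> ball z r"
    have "\<bar>fst (corner_coords z w)\<bar> \<le> dist w z" "\<bar>snd (corner_coords z w)\<bar> \<le> dist w z"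
      using corner_chart_coordinate_le[OF z, of "corner_coords z w" "(0, 0)"]
      by (simp_all add: base corner_chart_coords[OF z0])
    then show "w \<in> {w \<in> D. m w < r}" using w by (auto simp: m_def dist_commute)
  qed
  show "{w \<in> D. m w \<le> r} \<subseteq> cball z (4 * r)"
  proof
    fix w assume w: "w \<in> {w \<in> D. m w \<le> r}"
    obtain x y where xy: "corner_coords z w = (x, y)" by fastforce
    then have w': "w = corner_chart z (x, y)" using corner_chart_coords[OF z0, of w] by simp
    then have "x\<^sup>2 + y\<^sup>2 < x + y"
      using corner_chart_in_ball_iff[OF z, of x y] w by (simp add: D_def)
    then have "\<bar>x\<bar> \<le> r" "\<bar>y\<bar> \<le> r"
      using leg_coordinate_bound[of x y] leg_coordinate_bound[of y x] w
      by (cases "x \<le> y"; auto simp: m_def xy add.commute abs_le_iff)+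
    then have "sqrt (x\<^sup>2 + y\<^sup>2) \<le> r + r"
      using sqrt_sum_squares_le_sum_abs[of x y] by linarith
    moreover have "sqrt 2 \<le> 2" by (rule real_le_lsqrt) auto
    ultimately have "sqrt 2 * sqrt (x\<^sup>2 + y\<^sup>2) \<le> 2 * (r + r)"
      by (intro mult_mono) auto
    then show "w \<in> cball z (4 * r)"
      using dist_corner_chart[OF z, of "(0, 0)" "(x, y)"] by (simp add: base w')
  qed
  show "\<exists>L\<in>corner_legs z r. w \<in> L" if "m w = r" for w
  proof (cases "fst (corner_coords z w) \<le> snd (corner_coords z w)")
    case True
    then have "w = corner_chart z (fst (corner_coords z w), r)" "fst (corner_coords z w) \<le> r"
      using that chart[of w] by (auto simp: m_def)
    then have "w \<in> (\<lambda>t. corner_chart z (t, r)) ` {..r}" by (intro image_eqI) auto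
    then show ?thesis unfolding corner_legs_def by simp
  next
    case False
    then have "w = corner_chart z (r, snd (corner_coords z w))" "snd (corner_coords z w) \<le> r"
      using that chart[of w] by (auto simp: m_def)
    then have "w \<in> (\<lambda>t. corner_chart z (r, t)) ` {..r}" by (intro image_eqI) auto
    then show ?thesis unfolding corner_legs_def by simp
  qed
  have "r * r < r * 1" using r by (intro mult_strict_left_mono) auto
  then have "corner_chart z (r, r) \<in> D"
    unfolding D_def corner_chart_in_ball_iff[OF z] by (simp add: power2_eq_square)
  then show "corner_chart z (r, r) \<in> L \<inter> D" if "L \<in> corner_legs z r" for L
    using that by (auto simp: corner_legs_def)
qed

lemma quasiconformal_short_crosscut:
  fixes \<phi> :: "complex \<Rightarrow> 'a::metric_space"
  assumes qc: "quasiconformal (ball 0 1) W \<phi>" and fin: "hausdorff2 W < \<infinity>"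
    and z: "z \<in> sphere 0 1" and "0 < c" "0 < \<delta>"
  shows "has_short_crosscut \<phi> z c \<delta>"
proof -
  have nz: "norm z = 1" using z by simp
  have "0 < min 1 (\<delta> / 4)" "0 < c / 2" using \<open>0 < c\<close> \<open>0 < \<delta>\<close> by auto
  from quasiconformal_short_legs[OF qc fin nz this(2,1)]
  obtain r where r: "0 < r" "r < min 1 (\<delta> / 4)"
    and legs: "\<forall>L\<in>corner_legs z r. \<forall>a\<in>L \<inter> ball 0 1. \<forall>b\<in>L \<inter> ball 0 1. dist (\<phi> a) (\<phi> b) < c / 2"
    by blast
  define m where "m w = max (fst (corner_coords z w)) (snd (corner_coords z w))" for w
  have "r < 1" "4 * r < \<delta>" using r(2) by auto
  note cut = corner_crosscut[OF nz r(1) \<open>r < 1\<close>, folded m_def]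
  \<comment> \<open>Both legs contain the corner, so two short legs make a short crosscut.\<close>
  have half: "dist (\<phi> a) (\<phi> (corner_chart z (r, r))) < c / 2" if a: "a \<in> ball 0 1" "m a = r" for a
  proof -
    obtain L where "L \<in> corner_legs z r" "a \<in> L" using cut(5)[OF a(2)] by blast
    then show ?thesis using legs cut(6)[of L] a(1) by blast
  qed
  have "dist (\<phi> a) (\<phi> b) \<le> c" if "a \<in> ball 0 1" "m a = r" "b \<in> ball 0 1" "m b = r" for a b
    using dist_triangle_half_l[OF half[OF that(1,2)] half[OF that(3,4)]] by simp
  moreover have "{w \<in> ball 0 1. m w = r} \<union> {w \<in> ball 0 1. m w < r} \<subseteq> ball z \<delta>"
  proof -
    have "{w \<in> ball 0 1. m w = r} \<union> {w \<in> ball 0 1. m w < r} \<subseteq> cball z (4 * r)"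
      using cut(4) by auto
    also have "\<dots> \<subseteq> ball z \<delta>" using \<open>4 * r < \<delta>\<close> by auto
    finally show ?thesis .
  qed
  ultimately show ?thesis
    unfolding has_short_crosscut_def using cut(1-3) r(1)
    by (intro exI[of _ "{w \<in> ball 0 1. m w = r}"] exI[of _ "{w \<in> ball 0 1. m w < r}"]
        exI[of _ "{w \<in> ball 0 1. r < m w}"] exI[of _ r] conjI) auto
qed

section \<open>The extension\<close>

text \<open>
  By invariance of domain \<open>h ` Y\<close> is open in the plane, hence contained in the
  open disk. So \<open>h ` (Yc - Y)\<close> contains the unit circle, and being a topological circle, it is the unit
  circle.
\<close>

lemma Jordan_domain_interior:
  assumes h: "homeomorphism Yc (cball 0 1 :: complex set) h h'" and "Y \<subseteq> Yc"
    and bd: "(Yc - Y) homeomorphic (sphere 0 1 :: complex set)"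
    and \<phi>: "homeomorphism (ball 0 1 :: complex set) Y \<phi> \<phi>'"
  shows "h ` Y = ball 0 1" "h ` (Yc - Y) = sphere 0 1"
proof -
  have inj: "inj_on h Yc" using h by (metis homeomorphism_apply1 inj_on_inverseI)
  have img: "h ` Yc = cball 0 1" "\<phi> ` ball 0 1 = Y" using h \<phi> by (auto simp: homeomorphism_def)
  have "open ((h \<circ> \<phi>) ` ball 0 1)"
  proof (rule invariance_of_domain)
    show "continuous_on (ball 0 1) (h \<circ> \<phi>)"
      using h \<phi> \<open>Y \<subseteq> Yc\<close>
      by (intro continuous_on_compose) (auto simp: homeomorphism_def intro: continuous_on_subset)
    show "inj_on (h \<circ> \<phi>) (ball 0 1)"
    proof (rule comp_inj_on)
      show "inj_on \<phi> (ball 0 1)" using \<phi> by (metis homeomorphism_apply1 inj_on_inverseI)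
      show "inj_on h (\<phi> ` ball 0 1)" using inj img \<open>Y \<subseteq> Yc\<close> by (auto intro: inj_on_subset)
    qed
  qed simp
  then have "open (h ` Y)" by (metis image_comp img(2))
  moreover have sub: "h ` Y \<subseteq> cball 0 1" using img \<open>Y \<subseteq> Yc\<close> by blast
  ultimately have "h ` Y \<subseteq> ball 0 1" using interior_maximal[of "h ` Y" "cball 0 1"] by simp
  have diff: "h ` (Yc - Y) = cball 0 1 - h ` Y"
    using inj_on_image_set_diff[OF inj, of Yc Y] img \<open>Y \<subseteq> Yc\<close> by auto
  show "h ` (Yc - Y) = sphere 0 1"
  proof (rule sphere_subset_homeomorphic_sphere_eq)
    show "sphere 0 1 \<subseteq> h ` (Yc - Y)" unfolding diff using \<open>h ` Y \<subseteq> ball 0 1\<close> by auto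
    have "homeomorphism (Yc - Y) (h ` (Yc - Y)) h h'"
      using h by (rule homeomorphism_of_subsets) auto
    then have "h ` (Yc - Y) homeomorphic (Yc - Y)"
      using homeomorphic_def homeomorphic_sym by blast
    then show "h ` (Yc - Y) homeomorphic (sphere 0 1 :: complex set)"
      using bd homeomorphic_trans by blast
  qed
  then have "cball 0 1 - h ` Y = sphere 0 1" using diff by simp
  moreover have "ball 0 1 = cball 0 1 - sphere (0::complex) 1" by auto
  ultimately show "h ` Y = ball 0 1" using sub by blast
qed

theorem theorem1p1:
  fixes Y Yc :: "'a::metric_space set" and \<phi> :: "complex \<Rightarrow> 'a"
  assumes "quasiconformal_Jordan_domain Y Yc"
    and "quasiconformal (ball 0 1) Y \<phi>"
  shows "\<exists>\<Phi> :: complex \<Rightarrow> 'a.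
           (\<forall>z\<in>ball 0 1. \<Phi> z = \<phi> z) \<and>
           \<Phi> ` cball 0 1 = Yc \<and>
           continuum_monotone_map (cball 0 1) Yc \<Phi> \<and>
           \<Phi> ` sphere 0 1 = Yc - Y"
proof -
  have "metric_completion Y Yc" "Yc homeomorphic (cball 0 1 :: complex set)"
    and bd: "(Yc - Y) homeomorphic (sphere 0 1 :: complex set)" and "hausdorff2 Yc < \<infinity>"
    using assms(1) by (auto simp: quasiconformal_Jordan_domain_def metric_Jordan_domain_def)
  then have "Y \<subseteq> Yc" by (simp add: metric_completion_def)
  then have fin: "hausdorff2 Y < \<infinity>"
    using \<open>hausdorff2 Yc < \<infinity>\<close> hausdorff2_mono order_le_less_trans by blast
  obtain h h' where h: "homeomorphism Yc (cball 0 1 :: complex set) h h'"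
    using \<open>Yc homeomorphic _\<close> unfolding homeomorphic_def by blast
  obtain \<phi>' where \<phi>: "homeomorphism (ball 0 1) Y \<phi> \<phi>'"
    using assms(2) by (auto simp: quasiconformal_def K_quasiconformal_def)
  note hY = Jordan_domain_interior[OF h \<open>Y \<subseteq> Yc\<close> bd \<phi>]
  have h'h: "\<And>y. y \<in> Yc \<Longrightarrow> h' (h y) = y" and hh': "\<And>w. w \<in> cball 0 1 \<Longrightarrow> h (h' w) = w"
    and h'img: "h' ` cball 0 1 = Yc" and conth': "continuous_on (cball 0 1) h'" and conth: "continuous_on Yc h"
    using h by (auto simp: homeomorphism_def)
  have "homeomorphism Y (ball 0 1) h h'"
    by (rule homeomorphism_of_subsets[OF h \<open>Y \<subseteq> Yc\<close> order_refl hY(1)])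
  then have f: "homeomorphism (ball 0 1) (ball 0 1) (h \<circ> \<phi>) (\<phi>' \<circ> h')"
    using \<phi> homeomorphism_compose by blast
  have \<phi>Y: "\<phi> w \<in> Yc" if "w \<in> ball 0 1" for w
    using \<phi> that \<open>Y \<subseteq> Yc\<close> by (auto simp: homeomorphism_def)
  have "compact Yc" using h homeomorphic_compactness homeomorphic_def by (metis compact_cball)
  then have uc: "uniformly_continuous_on Yc h" using conth by (rule compact_uniformly_continuous[rotated])
  obtain F where F: "continuous_on (cball 0 1) F" "\<And>x. x \<in> ball 0 1 \<Longrightarrow> F x = (h \<circ> \<phi>) x"
    "F ` cball 0 1 = cball 0 1" "F ` sphere 0 1 = sphere 0 1" "\<And>y. connected {x \<in> cball 0 1. F x = y}"
  proof (rule ball_homeomorphism_extends[OF f])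
    fix z :: complex and s \<delta> :: real
    assume z: "z \<in> sphere 0 1" and "0 < s" "0 < \<delta>"
    obtain c where "0 < c" and c: "\<And>x y. x \<in> Yc \<Longrightarrow> y \<in> Yc \<Longrightarrow> dist x y < c \<Longrightarrow> dist (h x) (h y) < s"
      using uc \<open>0 < s\<close> unfolding uniformly_continuous_on_def by metis
    have "has_short_crosscut \<phi> z (c / 2) \<delta>"
      using \<open>0 < c\<close> by (intro quasiconformal_short_crosscut[OF assms(2) fin z _ \<open>0 < \<delta>\<close>]) simp
    then show "has_short_crosscut (h \<circ> \<phi>) z s \<delta>"
    proof (rule has_short_crosscut_compose)
      fix a b :: complex
      assume "a \<in> ball 0 1" "b \<in> ball 0 1" "dist (\<phi> a) (\<phi> b) \<le> c / 2"
      then show "dist (h (\<phi> a)) (h (\<phi> b)) \<le> s"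
        using c[OF \<phi>Y \<phi>Y] \<open>0 < c\<close> by (simp add: less_imp_le)
    qed
  qed blast
  have "\<forall>z\<in>ball 0 1. (h' \<circ> F) z = \<phi> z" using F(2) h'h \<phi>Y by simp
  moreover have "(h' \<circ> F) ` cball 0 1 = Yc" unfolding image_comp[symmetric] F(3) h'img ..
  moreover have "(h' \<circ> F) ` sphere 0 1 = Yc - Y"
  proof -
    have "(h' \<circ> F) ` sphere 0 1 = h' ` h ` (Yc - Y)" unfolding image_comp[symmetric] F(4) hY(2) ..
    also have "\<dots> = Yc - Y" using h'h by (force simp: image_image)
    finally show ?thesis .
  qed
  moreover have "continuum_monotone_map (cball 0 1) Yc (h' \<circ> F)"
    unfolding continuum_monotone_map_def
  proof (intro conjI ballI)
    show cont: "continuous_on (cball 0 1) (h' \<circ> F)"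
      using F(1) conth' F(3) by (intro continuous_on_compose) auto
    show "(h' \<circ> F) ` cball 0 1 \<subseteq> Yc" unfolding image_comp[symmetric] F(3) h'img ..
    fix y assume y: "y \<in> Yc"
    have fibre: "{x \<in> cball 0 1. (h' \<circ> F) x = y} = {x \<in> cball 0 1. F x = h y}"
    proof -
      have "h' (F x) = y \<longleftrightarrow> F x = h y" if "x \<in> cball 0 1" for x
      proof -
        have "F x \<in> cball 0 1" using F(3) that by blast
        then show ?thesis using hh'[of "F x"] h'h[OF y] by auto
      qed
      then show ?thesis by auto
    qed
    show "connected {x \<in> cball 0 1. (h' \<circ> F) x = y}" unfolding fibre by (rule F(5))
    have "closed {x \<in> cball 0 1. F x = h y}"
      using continuous_closed_preimage_constant[OF F(1) closed_cball] .
    then have "compact (cball 0 1 \<inter> {x \<in> cball 0 1. F x = h y})"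
      by (intro compact_Int_closed) auto
    moreover have "cball 0 1 \<inter> {x \<in> cball 0 1. F x = h y} = {x \<in> cball 0 1. F x = h y}" by auto
    ultimately show "compact {x \<in> cball 0 1. (h' \<circ> F) x = y}" unfolding fibre by simp
  qed
  ultimately show ?thesis by blast
qed

end
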